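(* Let $(X,\mathcal A,\mu,T)$ be a conservative ergodic infinite measure preserving system (as in the context). Let $N$ be a square integrable $T$-point process whose second order moment measure satisfies $$M_2^N(A_1\times A_2)=\mathbb E[N(A_1)N(A_2)]=\mu(A_1\cap A_2)+\mu(A_1)\mu(A_2)\qquad (A_1,A_2\in\mathcal A_f).$$ Then $N$ is a free $T$-point process. In particular, the Poisson process associated to the Poisson suspension $(X^*,\mathcal A^*,\mu^*,T_* )$ (i.e. the identity map $N=\mathrm{Id}$ on this system) is a free $T$-point process.
   Context: Setting. $X$ is a complete separable metric space with Borel $\sigma$-algebra $\mathcal A$; $\mu$ is a measure on $(X,\mathcal A)$ that is boundedly finite (finite on bounded Borel sets), with $\mu(X)=\infty$; $T:X\to X$ is invertible and preserves $\mu$, and $(X,\mathcal A,\mu,T)$ is conservative and ergodic. Put $\mathcal A_f=\{A\in\mathcal A: 0<\mu(A)<\infty\}$. $X^*$ is the set of boundedly finite simple counting measures $\xi=\sum_{i\in I}\delta_{x_i}$ ($I$ at most countable, $x_i\ne x_j$ for $i\neq j$), identified with the corresponding sets of points, and $\mathcal A^*$ is the $\sigma$-algebra on $X^*$ generated by the maps $\xi\mapsto \xi(A)$, $A$ bounded Borel. $T$-point process. $(\Omega,\mathscr F,\mathbb P)$ is a probability space and $S$ an invertible measure preserving transformation of it. A $T$-point process defined on $(\Omega,\mathscr F,\mathbb P,S)$ is a measurable map $N:\Omega\to X^*$ such that (i) for each $A\in\mathcal A$ with $\mu(A)=0$, $N(\omega)(A)=0$ for $\mathbb P$-a.e. $\omega$;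 (ii) for $\mathbb P$-a.e. $\omega$, for all $A\in\mathcal A$, $N(S\omega)(A)=N(\omega)(T^{-1}A)$. It is square integrable if $\mathbb E[N(A)^2]<\infty$ for all $A\in\mathcal A_f$. It is free if for $\mathbb P$-a.e. $\omega$, for all $k\in\mathbb Z\setminus\{0\}$, $N(\omega)\cap N(S^k\omega)=\emptyset$. Poisson suspension. $\mu^*$ is the distribution on $X^*$ of the Poisson point process of intensity $\mu$: under $\mu^*$, for mutually disjoint $A_1,\dots,A_k\in\mathcal A_f$, the variables $\xi(A_1),\dots,\xi(A_k)$ are independent and Poisson distributed with parameters $\mu(A_1),\dots,\mu(A_k)$. $T_*\xi=\xi\circ T^{-1}$ preserves $\mu^*$. *)

theory Defs
  imports "HOL-Probability.Probability"
begin

section \<open>The infinite measure preserving system\<close>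

definition boundedly_finite :: "'a::polish_space measure \<Rightarrow> bool" where
  "boundedly_finite \<mu> \<longleftrightarrow>
     sets \<mu> = sets borel \<and> (\<forall>B \<in> sets borel. bounded B \<longrightarrow> emeasure \<mu> B < \<infinity>)"

definition measure_preserving_map :: "'a measure \<Rightarrow> ('a \<Rightarrow> 'a) \<Rightarrow> bool" where
  "measure_preserving_map M T \<longleftrightarrow> T \<in> measurable M M \<and> distr M M T = M"

text \<open>Every wandering set is null, where \<open>A\<close> is wandering if the sets \<open>T\<^sup>-\<^sup>n A\<close>, \<open>n \<ge> 0\<close>, are
  pairwise disjoint.\<close>

definition conservative :: "'a measure \<Rightarrow> ('a \<Rightarrow> 'a) \<Rightarrow> bool" where
  "conservative M T \<longleftrightarrow>
     (\<forall>A \<in> sets M. disjoint_family (\<lambda>n::nat. (T ^^ n) -` A \<inter> space M) \<longrightarrow> emeasure M A = 0)"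

definition ergodic :: "'a measure \<Rightarrow> ('a \<Rightarrow> 'a) \<Rightarrow> bool" where
  "ergodic M T \<longleftrightarrow>
     (\<forall>A \<in> sets M. T -` A \<inter> space M = A \<longrightarrow> emeasure M A = 0 \<or> emeasure M (space M - A) = 0)"

definition infinite_mp_system :: "'a::polish_space measure \<Rightarrow> ('a \<Rightarrow> 'a) \<Rightarrow> bool" where
  "infinite_mp_system \<mu> T \<longleftrightarrow>
     boundedly_finite \<mu> \<and> emeasure \<mu> UNIV = \<infinity> \<and>
     bij T \<and> inv T \<in> measurable \<mu> \<mu> \<and> measure_preserving_map \<mu> T \<and>
     conservative \<mu> T \<and> ergodic \<mu> T"

definition pos_finite_sets :: "'a measure \<Rightarrow> 'a set set" where
  "pos_finite_sets M = {A \<in> sets M. 0 < emeasure M A \<and> emeasure M A < \<infinity>}"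


section \<open>Configurations\<close>

text \<open>A boundedly finite simple counting measure \<open>\<xi>\<close> is represented by its set of points; it is
  recovered from this set as \<open>A \<mapsto> pt_count \<xi> A\<close>. Countability is automatic, since the
  space is a countable union of balls.\<close>

definition Xstar :: "'a::polish_space set set" where
  "Xstar = {\<xi>. \<forall>B. bounded B \<longrightarrow> finite (\<xi> \<inter> B)}"

definition pt_count :: "'a set \<Rightarrow> 'a set \<Rightarrow> ennreal" where
  "pt_count \<xi> A = emeasure (count_space UNIV) (\<xi> \<inter> A)"

definition Astar :: "'a::polish_space set measure" where
  "Astar = sigma Xstar
     {(\<lambda>\<xi>. pt_count \<xi> A) -` C \<inter> Xstar | A C. A \<in> sets borel \<and> bounded A \<and> C \<in> sets borel}"


section \<open>Point processes\<close>

text \<open>\<open>S\<close> is an invertible measure preserving transformation of the probability space \<open>P\<close>, with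
  inverse \<open>S'\<close>. As usual for measure preserving systems, invertibility is understood modulo
  null sets: the transformation induced by \<open>T\<close> on configurations, to which this is
  applied below, is only almost everywhere defined (see \<open>push_config\<close>). If \<open>S\<close> is a bijection
  of \<open>space P\<close> with measurable inverse, one may take the exact inverse for \<open>S'\<close>.\<close>

definition prob_automorphism :: "'w measure \<Rightarrow> ('w \<Rightarrow> 'w) \<Rightarrow> ('w \<Rightarrow> 'w) \<Rightarrow> bool" where
  "prob_automorphism P S S' \<longleftrightarrow>
     prob_space P \<and> measure_preserving_map P S \<and> S' \<in> measurable P P \<and>
     (AE \<omega> in P. S' (S \<omega>) = \<omega>) \<and> (AE \<omega> in P. S (S' \<omega>) = \<omega>)"

definition int_iterate :: "('w \<Rightarrow> 'w) \<Rightarrow> ('w \<Rightarrow> 'w) \<Rightarrow> int \<Rightarrow> 'w \<Rightarrow> 'w" where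
  "int_iterate S S' k = (if 0 \<le> k then S ^^ nat k else S' ^^ nat (- k))"

definition T_point_process ::
  "'a::polish_space measure \<Rightarrow> ('a \<Rightarrow> 'a) \<Rightarrow>
   'w measure \<Rightarrow> ('w \<Rightarrow> 'w) \<Rightarrow> ('w \<Rightarrow> 'w) \<Rightarrow> ('w \<Rightarrow> 'a set) \<Rightarrow> bool" where
  "T_point_process \<mu> T P S S' N \<longleftrightarrow>
     prob_automorphism P S S' \<and> N \<in> measurable P Astar \<and>
     (\<forall>A \<in> sets borel. emeasure \<mu> A = 0 \<longrightarrow> (AE \<omega> in P. pt_count (N \<omega>) A = 0)) \<and>
     (AE \<omega> in P. \<forall>A \<in> sets borel. pt_count (N (S \<omega>)) A = pt_count (N \<omega>) (T -` A))"

definition second_moment :: "'w measure \<Rightarrow> ('w \<Rightarrow> 'a set) \<Rightarrow> 'a set \<Rightarrow> 'a set \<Rightarrow> ennreal" where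
  \<comment> \<open>the value on the rectangle \<open>A\<^sub>1 \<times> A\<^sub>2\<close> of the second order moment measure of \<open>N\<close>\<close>
  "second_moment P N A\<^sub>1 A\<^sub>2 = (\<integral>\<^sup>+ \<omega>. pt_count (N \<omega>) A\<^sub>1 * pt_count (N \<omega>) A\<^sub>2 \<partial>P)"

definition square_integrable ::
  "'a measure \<Rightarrow> 'w measure \<Rightarrow> ('w \<Rightarrow> 'a set) \<Rightarrow> bool" where
  "square_integrable \<mu> P N \<longleftrightarrow>
     (\<forall>A \<in> pos_finite_sets \<mu>. (\<integral>\<^sup>+ \<omega>. (pt_count (N \<omega>) A)\<^sup>2 \<partial>P) < \<infinity>)"

definition free_T_point_process ::
  "'a::polish_space measure \<Rightarrow> ('a \<Rightarrow> 'a) \<Rightarrow>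
   'w measure \<Rightarrow> ('w \<Rightarrow> 'w) \<Rightarrow> ('w \<Rightarrow> 'w) \<Rightarrow> ('w \<Rightarrow> 'a set) \<Rightarrow> bool" where
  "free_T_point_process \<mu> T P S S' N \<longleftrightarrow>
     T_point_process \<mu> T P S S' N \<and>
     (AE \<omega> in P. \<forall>k::int. k \<noteq> 0 \<longrightarrow> N \<omega> \<inter> N (int_iterate S S' k \<omega>) = {})"


section \<open>The Poisson suspension\<close>

definition poisson_law :: "'a::polish_space measure \<Rightarrow> 'a set measure \<Rightarrow> bool" where
  "poisson_law \<mu> Q \<longleftrightarrow>
     prob_space Q \<and> space Q = Xstar \<and> sets Q = sets Astar \<and>
     (\<forall>A \<in> pos_finite_sets \<mu>.
        distr Q borel (\<lambda>\<xi>. pt_count \<xi> A) =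
        distr (measure_pmf (poisson_pmf (measure \<mu> A))) borel of_nat) \<and>
     (\<forall>(k::nat) A. (\<forall>i<k. A i \<in> pos_finite_sets \<mu>) \<and> disjoint_family_on A {..<k} \<longrightarrow>
        prob_space.indep_vars Q (\<lambda>_. borel) (\<lambda>i \<xi>. pt_count \<xi> (A i)) {..<k})"

text \<open>In terms of sets of points, \<open>\<xi> \<circ> T\<^sup>-\<^sup>1\<close> is the image of \<open>\<xi>\<close> under \<open>T\<close>. As \<open>T\<close> need not
  preserve bounded sets, this image need not be boundedly finite; the empty configuration
  is an arbitrary value on the (null) set where it is not.\<close>

definition push_config :: "('a::polish_space \<Rightarrow> 'a) \<Rightarrow> 'a set \<Rightarrow> 'a set" where
  "push_config T \<xi> = (if T ` \<xi> \<in> Xstar then T ` \<xi> else {})"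

end

theory Submission
  imports Defs
begin

text \<open>Equivariance gives \<open>N(S\<^sup>k \<omega>) = T\<^sup>k N(\<omega>)\<close> almost surely, so a common point of \<open>N(\<omega>)\<close> and
\<open>N(S\<^sup>k \<omega>)\<close> is a point \<open>T\<^sup>k y\<close> such that \<open>(y, T\<^sup>k y)\<close> is a pair of points of \<open>N(\<omega>)\<close> on the
graph of \<open>T\<^sup>k\<close>. The expected number of such pairs is the mass that the second moment measure, which is
\<open>\<mu> \<times> \<mu>\<close> plus the image of \<open>\<mu>\<close> on the diagonal, gives to the graph. There are two reasons why this
mass is zero for \<open>k \<noteq> 0\<close>.

The graph meets the diagonal in the points of period \<open>k\<close>, and these form a null set
(\<open>periodic_points_null\<close>): otherwise a bounded set of them would generate an invariant set of
positive and finite measure, against ergodicity and the infinite total mass. Moreover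
\<open>\<mu>\<close> has no atoms (\<open>atomless\<close>), since a point that is not periodic is a wandering set; and
the product of an atomless measure with itself does not charge graphs.

The second moment is only given on rectangles. Instead of constructing the
moment measure, \<open>no_points_on_graph_piece\<close> covers the graph away from the diagonal by rectangles
\<open>A \<times> T\<^sup>k A\<close> with \<open>A\<close> and \<open>T\<^sup>k A\<close> disjoint and \<open>A\<close> small, whose masses \<open>\<mu>(A)\<^sup>2\<close> have a small sum.

For the Poisson suspension, independence on disjoint sets yields the second moment
(\<open>poisson_law_disjoint_moment\<close>). What takes work is that \<open>push_config T\<close> is
an automorphism of the law. It is defined by images of configurations almost everywhere because preimages
of balls have finite measure (\<open>AE_image_in_Xstar\<close>), and it preserves the law because a
law on configurations is determined by its values on finitely many disjoint sets of positive finite measure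
(\<open>config_law_unique\<close>), and \<open>T\<close> preserves their measures.\<close>

section \<open>Counting points\<close>

lemma pt_count_eq_0_iff: "pt_count \<xi> A = 0 \<longleftrightarrow> \<xi> \<inter> A = {}"
  by (simp add: pt_count_def emeasure_count_space_eq_0)

lemma pt_count_finite_iff: "pt_count \<xi> A < \<infinity> \<longleftrightarrow> finite (\<xi> \<inter> A)"
  by (simp add: pt_count_def emeasure_count_space of_nat_less_top)

lemma one_le_pt_count:
  assumes "\<xi> \<inter> A \<noteq> {}" shows "1 \<le> pt_count \<xi> A"
proof -
  obtain x where "x \<in> \<xi> \<inter> A" using assms by blast
  then have "emeasure (count_space UNIV) {x} \<le> pt_count \<xi> A"
    unfolding pt_count_def by (intro emeasure_mono) auto
  then show ?thesis by simp
qed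

lemma pt_count_Un_disjoint:
  "A \<inter> B = {} \<Longrightarrow> pt_count \<xi> (A \<union> B) = pt_count \<xi> A + pt_count \<xi> B"
  using plus_emeasure[of "\<xi> \<inter> A" "count_space UNIV" "\<xi> \<inter> B"]
  by (simp add: pt_count_def Int_Un_distrib disjoint_iff)

lemma pt_count_UN_disjoint:
  assumes "finite I" "disjoint_family_on A I"
  shows "pt_count \<xi> (\<Union>i\<in>I. A i) = (\<Sum>i\<in>I. pt_count \<xi> (A i))"
proof -
  have "disjoint_family_on (\<lambda>i. \<xi> \<inter> A i) I"
    using assms(2) by (auto simp: disjoint_family_on_def)
  then show ?thesis
    using assms(1) sum_emeasure[of "\<lambda>i. \<xi> \<inter> A i" I "count_space UNIV"]
    by (simp add: pt_count_def)
qed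

text \<open>Both sides count the same points, since \<open>T\<close> maps \<open>\<xi> \<inter> T -` A\<close> bijectively onto \<open>T ` \<xi> \<inter> A\<close>. This
translates the equivariance condition on counts into an equality of configurations.\<close>

lemma pt_count_image:
  assumes "bij T" shows "pt_count (T ` \<xi>) A = pt_count \<xi> (T -` A)"
proof -
  have inj: "inj_on T (\<xi> \<inter> T -` A)" using assms by (meson bij_is_inj inj_on_subset subset_UNIV)
  have eq: "T ` \<xi> \<inter> A = T ` (\<xi> \<inter> T -` A)" by auto
  show ?thesis
    unfolding pt_count_def eq
    by (simp add: emeasure_count_space finite_image_iff[OF inj] card_image[OF inj])
qed

lemma pt_count_singleton_eq_0_iff: "pt_count \<xi> {x} = 0 \<longleftrightarrow> x \<notin> \<xi>"
  by (auto simp: pt_count_eq_0_iff)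

lemma space_Astar [simp]: "space Astar = Xstar"
  unfolding Astar_def by (auto intro!: space_measure_of)

lemma measurable_pt_count_bounded:
  assumes "A \<in> sets borel" "bounded A"
  shows "(\<lambda>\<xi>. pt_count \<xi> A) \<in> borel_measurable Astar"
proof (rule measurableI)
  fix C :: "ennreal set" assume "C \<in> sets borel"
  then show "(\<lambda>\<xi>. pt_count \<xi> A) -` C \<inter> space Astar \<in> sets Astar"
    unfolding space_Astar unfolding Astar_def using assms by (subst sets_measure_of) auto
qed simp

text \<open>The generators of the \<open>\<sigma>\<close>-algebra only involve bounded sets, but images of bounded sets
under the transformation may be unbounded. The count of an unbounded set is the supremum of
the counts of its intersections with balls of integer radius.\<close>

lemma measurable_pt_count [measurable]:
  fixes A :: "'a::polish_space set"
  assumes [measurable]: "A \<in> sets borel"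
  shows "(\<lambda>\<xi>. pt_count \<xi> A) \<in> borel_measurable Astar"
proof -
  define x0 :: 'a where "x0 = undefined"
  have "pt_count \<xi> A = (SUP n::nat. pt_count \<xi> (A \<inter> ball x0 (real n)))" for \<xi>
  proof -
    have "(\<Union>n::nat. \<xi> \<inter> (A \<inter> ball x0 (real n))) = \<xi> \<inter> A"
      using reals_Archimedean2 by auto
    moreover have "incseq (\<lambda>n::nat. \<xi> \<inter> (A \<inter> ball x0 (real n)))"
      by (auto simp: incseq_def)
    ultimately show ?thesis
      unfolding pt_count_def by (subst SUP_emeasure_incseq) auto
  qed
  moreover have "(\<lambda>\<xi>. SUP n::nat. pt_count \<xi> (A \<inter> ball x0 (real n))) \<in> borel_measurable Astar"
    by (intro borel_measurable_SUP measurable_pt_count_bounded)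
      (simp_all add: bounded_Int)
  ultimately show ?thesis by simp
qed

lemma in_Xstar_iff_balls:
  "\<xi> \<in> Xstar \<longleftrightarrow> (\<forall>n::nat. pt_count \<xi> (ball x0 (real n)) < \<infinity>)"
proof
  assume "\<xi> \<in> Xstar" then show "\<forall>n::nat. pt_count \<xi> (ball x0 (real n)) < \<infinity>"
    unfolding pt_count_finite_iff by (simp add: Xstar_def)
next
  assume *: "\<forall>n::nat. pt_count \<xi> (ball x0 (real n)) < \<infinity>"
  show "\<xi> \<in> Xstar" unfolding Xstar_def
  proof (safe)
    fix B :: "'a set" assume "bounded B"
    then obtain r where r: "B \<subseteq> ball x0 r" by (metis bounded_subset_ballD)
    obtain n :: nat where "r < real n" using reals_Archimedean2 by blast
    with r have "\<xi> \<inter> B \<subseteq> \<xi> \<inter> ball x0 (real n)" by fastforce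
    with * show "finite (\<xi> \<inter> B)" unfolding pt_count_finite_iff by (metis finite_subset)
  qed
qed

section \<open>Periodic points and atoms\<close>

text \<open>The transformations to which the argument is applied are the powers \<open>T\<^sup>k\<close>, \<open>k \<in> \<int>\<close>; this notion
collects what is used of them and is closed under powers and inverses.\<close>

definition mp_bijection :: "'a::polish_space measure \<Rightarrow> ('a \<Rightarrow> 'a) \<Rightarrow> bool" where
  "mp_bijection \<mu> R \<longleftrightarrow> bij R \<and> R \<in> borel_measurable borel \<and> inv R \<in> borel_measurable borel \<and>
     (\<forall>A \<in> sets borel. emeasure \<mu> (R -` A) = emeasure \<mu> A)"

lemma borel_vimage:
  "R \<in> borel_measurable borel \<Longrightarrow> A \<in> sets borel \<Longrightarrow> R -` A \<in> sets borel"
  using measurable_sets[of R borel borel A] by simp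

lemma mp_bijection_inv:
  assumes "mp_bijection \<mu> R" shows "mp_bijection \<mu> (inv R)"
proof -
  have R: "bij R" "R \<in> borel_measurable borel" "inv R \<in> borel_measurable borel"
    and p: "\<And>A. A \<in> sets borel \<Longrightarrow> emeasure \<mu> (R -` A) = emeasure \<mu> A"
    using assms by (auto simp: mp_bijection_def)
  have "emeasure \<mu> (inv R -` A) = emeasure \<mu> A" if "A \<in> sets borel" for A
    using p[OF borel_vimage[OF R(3) that]] R(1)
    by (simp add: vimage_comp bij_is_inj)
  then show ?thesis
    using R by (simp add: mp_bijection_def bij_imp_bij_inv inv_inv_eq)
qed

lemma mp_bijection_funpow:
  assumes "mp_bijection \<mu> R" shows "mp_bijection \<mu> (R ^^ n)"
proof -
  have R: "bij R" "R \<in> borel_measurable borel" "inv R \<in> borel_measurable borel"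
    and p: "\<And>A. A \<in> sets borel \<Longrightarrow> emeasure \<mu> (R -` A) = emeasure \<mu> A"
    using assms by (auto simp: mp_bijection_def)
  have m: "(f ^^ m) \<in> borel_measurable borel" if "f \<in> borel_measurable borel" for f :: "'a \<Rightarrow> 'a" and m
    proof (induction m)
    case (Suc m)
    then show ?case using measurable_comp[OF Suc that] by (simp add: comp_def)
  qed (simp add: id_def)
  have "emeasure \<mu> ((R ^^ n) -` A) = emeasure \<mu> A" if "A \<in> sets borel" for A
  proof (induction n)
    case (Suc n)
    have "(R ^^ Suc n) -` A = R -` ((R ^^ n) -` A)"
      by (simp only: funpow_Suc_right vimage_comp)
    then show ?case using p[OF borel_vimage[OF m[OF R(2)] that]] Suc by (simp only:)
  qed simp
  then show ?thesis
    using R m by (simp add: mp_bijection_def bij_fn inv_fn)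
qed

lemma mp_bijection_int_iterate:
  "mp_bijection \<mu> R \<Longrightarrow> mp_bijection \<mu> (int_iterate R (inv R) k)"
  by (simp add: int_iterate_def mp_bijection_funpow mp_bijection_inv)

lemma infinite_mp_systemD:
  assumes "infinite_mp_system \<mu> T"
  shows "sets \<mu> = sets borel" "space \<mu> = UNIV" "boundedly_finite \<mu>"
    "\<And>B. bounded B \<Longrightarrow> B \<in> sets borel \<Longrightarrow> emeasure \<mu> B < \<infinity>"
    "emeasure \<mu> UNIV = \<infinity>" "mp_bijection \<mu> T"
proof -
  have T: "bij T" "inv T \<in> measurable \<mu> \<mu>" "measure_preserving_map \<mu> T" "boundedly_finite \<mu>"
    using assms by (auto simp: infinite_mp_system_def)
  show s: "sets \<mu> = sets borel" using T by (auto simp: boundedly_finite_def)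
  show sp: "space \<mu> = UNIV" using sets_eq_imp_space_eq[OF s] by simp
  show "boundedly_finite \<mu>" by fact
  show "\<And>B. bounded B \<Longrightarrow> B \<in> sets borel \<Longrightarrow> emeasure \<mu> B < \<infinity>"
    using T by (auto simp: boundedly_finite_def)
  show "emeasure \<mu> UNIV = \<infinity>" using assms by (auto simp: infinite_mp_system_def)
  have m: "T \<in> measurable \<mu> \<mu>" "distr \<mu> \<mu> T = \<mu>"
    using T(3) by (auto simp: measure_preserving_map_def)
  have "emeasure \<mu> (T -` A) = emeasure \<mu> A" if "A \<in> sets borel" for A
    using emeasure_distr[OF m(1), of A] that m(2) s sp by simp
  then show "mp_bijection \<mu> T"
    using T m measurable_cong_sets[OF s s] by (auto simp: mp_bijection_def)
qed

lemma fixed_points_measurable: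
  fixes R :: "'a::polish_space \<Rightarrow> 'a"
  assumes [measurable]: "R \<in> borel_measurable borel"
  shows "{x. R x = x} \<in> sets borel"
proof -
  have "{x \<in> space borel. dist (R x) x = 0} \<in> sets borel" by measurable
  then show ?thesis by simp
qed

text \<open>The union of the balls of integer radius around \<open>x0\<close> is the whole space, which
brings bounded finiteness to bear on unbounded sets.\<close>

lemma null_if_null_on_balls:
  fixes \<mu> :: "'a::polish_space measure"
  assumes "sets \<mu> = sets borel" "F \<in> sets borel"
    and "\<And>n::nat. emeasure \<mu> (F \<inter> ball x0 (real n)) = 0"
  shows "emeasure \<mu> F = 0"
proof -
  have "(\<Union>n::nat. F \<inter> ball x0 (real n)) = F"
    using reals_Archimedean2 by auto
  moreover have "emeasure \<mu> (\<Union>n::nat. F \<inter> ball x0 (real n)) = 0"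
    using assms by (intro emeasure_UN_eq_0) auto
  ultimately show ?thesis by simp
qed

text \<open>Let \<open>B\<close> be a bounded set of points \<open>x\<close> with \<open>T\<^sup>k x = x\<close>. The union of its first \<open>k\<close> preimages
is invariant and has measure at most \<open>k \<mu>(B) < \<infinity>\<close>. The total mass being infinite, its
complement is not null, so by ergodicity the union itself is, and \<open>B\<close> with it.\<close>

lemma periodic_points_null:
  assumes sys: "infinite_mp_system \<mu> T" and k: "0 < k"
  shows "emeasure \<mu> {x. (T ^^ k) x = x} = 0"
proof -
  note S = infinite_mp_systemD[OF sys]
  let ?F = "{x. (T ^^ k) x = x}"
  have pow: "mp_bijection \<mu> (T ^^ j)" for j using S(6) by (rule mp_bijection_funpow)
  have mpow: "(T ^^ j) \<in> borel_measurable borel" for j using pow[of j] by (simp add: mp_bijection_def)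
  have F: "?F \<in> sets borel" by (rule fixed_points_measurable[OF mpow])
  have inj: "inj T" using S(6) by (simp add: mp_bijection_def bij_is_inj)
  define x0 :: 'a where "x0 = undefined"
  show ?thesis
  proof (rule null_if_null_on_balls[OF S(1) F])
    fix n :: nat
    define B where "B = ?F \<inter> ball x0 (real n)"
    define W where "W = (\<Union>j<k. (T ^^ j) -` B)"
    have B: "B \<in> sets borel" "bounded B"
      unfolding B_def using F by (simp_all add: bounded_Int)
    have Bj: "(T ^^ j) -` B \<in> sets borel" for j by (rule borel_vimage[OF mpow B(1)])
    have W: "W \<in> sets borel" unfolding W_def using Bj by auto
    \<comment> \<open>\<open>T -` W\<close> is the union over \<open>1, \<dots>, k\<close>, where the term of index \<open>k\<close> equals the one of index 0
      since the points of \<open>B\<close> have period \<open>k\<close>\<close>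
    have "(T ^^ k) -` B = B"
    proof -
      have "(T ^^ k) y = y" if "(T ^^ k) y \<in> B" for y
      proof -
        have "(T ^^ k) ((T ^^ k) y) = (T ^^ k) y" using that by (simp add: B_def)
        then show ?thesis using inj_fn[OF inj, of k] by (simp add: inj_eq)
      qed
      moreover have "(T ^^ k) y = y" if "y \<in> B" for y using that by (simp add: B_def)
      ultimately show ?thesis by fastforce
    qed
    moreover have "{Suc 0..<Suc k} = insert k {Suc 0..<k}" "{..<k} = insert 0 {Suc 0..<k}"
      using k by auto
    ultimately have "(\<Union>j\<in>{Suc 0..<Suc k}. (T ^^ j) -` B) = W"
      unfolding W_def by simp
    moreover have "T -` W = (\<Union>j\<in>{Suc 0..<Suc k}. (T ^^ j) -` B)"
    proof -
      have "T -` W = (\<Union>j<k. (T ^^ Suc j) -` B)"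
        unfolding W_def by (simp only: vimage_UN vimage_comp funpow_Suc_right)
      also have "\<dots> = (\<Union>j\<in>Suc ` {0..<k}. (T ^^ j) -` B)"
        by (simp only: image_image lessThan_atLeast0)
      finally show ?thesis by (simp only: image_Suc_atLeastLessThan)
    qed
    ultimately have "T -` W \<inter> space \<mu> = W" by (simp add: S(2))
    then have erg: "emeasure \<mu> W = 0 \<or> emeasure \<mu> (space \<mu> - W) = 0"
      using sys W S(1) by (simp add: infinite_mp_system_def ergodic_def)
    have "emeasure \<mu> W \<le> (\<Sum>j<k. emeasure \<mu> ((T ^^ j) -` B))"
      unfolding W_def using Bj S(1) by (intro emeasure_subadditive_finite) auto
    also have "\<dots> = (\<Sum>j<k. emeasure \<mu> B)"
      using pow B by (simp add: mp_bijection_def)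
    also have "\<dots> < \<infinity>" using S(4)[OF B(2,1)] by (simp add: ennreal_mult_less_top of_nat_less_top)
    finally have Wfin: "emeasure \<mu> W < \<infinity>" .
    have "emeasure \<mu> (space \<mu> - W) \<noteq> 0"
    proof
      assume "emeasure \<mu> (space \<mu> - W) = 0"
      then have "emeasure \<mu> (W \<union> (space \<mu> - W)) \<le> emeasure \<mu> W"
        using emeasure_subadditive[of W \<mu> "space \<mu> - W"] W S(1,2) by (simp add: Compl_eq_Diff_UNIV[symmetric])
      then show False using Wfin S(2,5) by simp
    qed
    then have W0: "emeasure \<mu> W = 0" using erg by blast
    have "(T ^^ 0) -` B \<subseteq> W" unfolding W_def using k by blast
    then have "emeasure \<mu> B \<le> emeasure \<mu> W" using W S(1) by (intro emeasure_mono) auto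
    then show "emeasure \<mu> (?F \<inter> ball x0 (real n)) = 0" using W0 by (simp add: B_def)
  qed
qed

text \<open>A periodic point lies in one of the null sets of the previous lemma. A point that is not
periodic is a wandering set, and hence null by conservativity.\<close>

lemma atomless:
  assumes sys: "infinite_mp_system \<mu> T"
  shows "emeasure \<mu> {x} = 0"
proof (cases "\<exists>k>0. (T ^^ k) x = x")
  case True
  then obtain k where k: "0 < k" "(T ^^ k) x = x" by blast
  note S = infinite_mp_systemD[OF sys]
  have "{x. (T ^^ k) x = x} \<in> sets \<mu>"
    using mp_bijection_funpow[OF S(6), of k] fixed_points_measurable S(1) by (auto simp: mp_bijection_def)
  then have "emeasure \<mu> {x} \<le> emeasure \<mu> {x. (T ^^ k) x = x}"
    using k by (intro emeasure_mono) auto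
  then show ?thesis using periodic_points_null[OF sys k(1)] by simp
next
  case False
  note S = infinite_mp_systemD[OF sys]
  have "(T ^^ m) y \<noteq> x \<or> (T ^^ n) y \<noteq> x" if "m < n" for m n y
  proof -
    have "n = (n - m) + m" using that by simp
    then have "(T ^^ n) y = (T ^^ (n - m)) ((T ^^ m) y)" by (metis comp_apply funpow_add)
    moreover have "(T ^^ (n - m)) x \<noteq> x" using False that zero_less_diff by blast
    ultimately show ?thesis by auto
  qed
  then have "(T ^^ m) -` {x} \<inter> (T ^^ n) -` {x} = {}" if "m \<noteq> n" for m n
    using that by (cases m n rule: linorder_cases) fastforce+
  then have "disjoint_family (\<lambda>n. (T ^^ n) -` {x} \<inter> space \<mu>)"
    unfolding disjoint_family_on_def by blast
  then show ?thesis
    using sys S(1) by (auto simp: infinite_mp_system_def conservative_def)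
qed

lemma int_iterate_fixed_points_null:
  assumes sys: "infinite_mp_system \<mu> T" and k: "k \<noteq> 0"
  shows "emeasure \<mu> {x. int_iterate T (inv T) k x = x} = 0"
proof -
  have b: "bij T" using infinite_mp_systemD(6)[OF sys] by (simp add: mp_bijection_def)
  have "(inv T ^^ n) x = x \<longleftrightarrow> (T ^^ n) x = x" for n x
    using b by (metis bij_fn bij_inv_eq_iff inv_fn)
  then have "{x. int_iterate T (inv T) k x = x} = {x. (T ^^ nat \<bar>k\<bar>) x = x}"
    by (auto simp: int_iterate_def)
  then show ?thesis using periodic_points_null[OF sys] k by simp
qed

section \<open>Points on the graph of a transformation\<close>

text \<open>Every point has mass zero, so it has neighbourhoods of arbitrarily small measure; countably
many of them cover the space, and they can be made disjoint. Boundedness of small balls gives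
the finiteness required for continuity of the measure from above.\<close>

lemma small_partition:
  fixes \<mu> :: "'a::polish_space measure"
  assumes bf: "boundedly_finite \<mu>" and atom: "\<And>x. emeasure \<mu> {x} = 0" and e: "0 < (e::ennreal)"
  shows "\<exists>U :: nat \<Rightarrow> 'a set. (\<forall>i. U i \<in> sets borel \<and> emeasure \<mu> (U i) \<le> e) \<and>
    disjoint_family U \<and> (\<Union>i. U i) = UNIV"
proof -
  have s: "sets \<mu> = sets borel" using bf by (simp add: boundedly_finite_def)
  obtain \<B> :: "'a set set" where B: "countable \<B>" "topological_basis \<B>"
    using ex_countable_basis by blast
  define \<C> where "\<C> = {U\<in>\<B>. emeasure \<mu> U < e}"
  have C: "countable \<C>" using B(1) by (simp add: \<C>_def)
  have cover: "\<exists>U\<in>\<C>. x \<in> U" for x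
  proof -
    let ?b = "\<lambda>n::nat. ball x (1 / real (Suc n))"
    have "(\<lambda>n. emeasure \<mu> (?b n)) \<longlonglongrightarrow> emeasure \<mu> (\<Inter>n. ?b n)"
    proof (rule Lim_emeasure_decseq)
      show "decseq ?b" by (auto simp: decseq_def frac_le intro!: subset_ball)
      show "emeasure \<mu> (?b n) \<noteq> \<infinity>" for n
        using bf by (simp add: boundedly_finite_def less_top)
    qed (auto simp: s)
    moreover have "(\<Inter>n. ?b n) = {x}"
    proof -
      have "y = x" if "\<forall>n. y \<in> ?b n" for y
      proof (rule ccontr)
        assume "y \<noteq> x"
        then obtain n where "inverse (real (Suc n)) < dist x y"
          using reals_Archimedean[of "dist x y"] by auto
        then show False using that[rule_format, of n] by (simp add: inverse_eq_divide)
      qed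
      then show ?thesis by auto
    qed
    ultimately have "(\<lambda>n. emeasure \<mu> (?b n)) \<longlonglongrightarrow> 0" using atom by simp
    then have "\<forall>\<^sub>F n in sequentially. emeasure \<mu> (?b n) < e"
      using e by (rule order_tendstoD(2))
    then obtain n where n: "emeasure \<mu> (?b n) < e" by (auto simp: eventually_sequentially)
    obtain U where U: "U \<in> \<B>" "x \<in> U" "U \<subseteq> ?b n"
      using topological_basisE[OF B(2), of "?b n" x] by auto
    have "emeasure \<mu> U \<le> emeasure \<mu> (?b n)" using U s by (intro emeasure_mono) auto
    with n U show ?thesis by (auto simp: \<C>_def)
  qed
  then have ne: "\<C> \<noteq> {}" by blast
  define V where "V = from_nat_into \<C>"
  have V: "V i \<in> \<C>" for i unfolding V_def using ne by (rule from_nat_into)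
  have VB: "V i \<in> sets borel" for i
    using V[of i] B(2) by (auto simp: \<C>_def dest: topological_basis_open)
  have "(\<Union>i. V i) = UNIV"
    using cover C ne unfolding V_def by (auto simp: range_from_nat_into)
  show ?thesis
  proof (intro exI[of _ "disjointed V"] conjI allI)
    show "disjointed V i \<in> sets borel" for i using sets.range_disjointed_sets[of V borel] VB by auto
    show "disjoint_family (disjointed V)" by (rule disjoint_family_disjointed)
    show "(\<Union>i. disjointed V i) = UNIV" using \<open>(\<Union>i. V i) = UNIV\<close> by (simp add: UN_disjointed_eq)
    show "emeasure \<mu> (disjointed V i) \<le> e" for i
    proof -
      have "emeasure \<mu> (disjointed V i) \<le> emeasure \<mu> (V i)"
        using VB s disjointed_subset[of V i] by (intro emeasure_mono) auto
      also have "\<dots> \<le> e" using V[of i] by (auto simp: \<C>_def)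
      finally show ?thesis .
    qed
  qed
qed

text \<open>The heart of the matter. Cut \<open>B\<close> into pieces \<open>A\<^sub>i\<close> of measure at most \<open>\<epsilon>\<close>. If \<open>N\<close> contains
both \<open>y \<in> A\<^sub>i\<close> and \<open>R y\<close>, then \<open>N(A\<^sub>i) N(R A\<^sub>i) \<ge> 1\<close>. As \<open>R A\<^sub>i\<close> is disjoint from \<open>A\<^sub>i\<close> and has
the same measure, Markov's inequality bounds the probability of this by
\<open>\<mu>(A\<^sub>i)\<^sup>2 \<le> \<epsilon> \<mu>(A\<^sub>i)\<close>. The sum over \<open>i\<close> is at most \<open>\<epsilon> \<mu>(B)\<close>, which is as small as desired. In
terms of the second moment measure, this says that \<open>\<mu> \<times> \<mu>\<close> does not charge the graph
of \<open>R\<close>.\<close>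

lemma no_points_on_graph_piece:
  fixes \<mu> :: "'a::polish_space measure"
  assumes bf: "boundedly_finite \<mu>" and atom: "\<And>x. emeasure \<mu> {x} = 0"
    and N: "N \<in> measurable P Astar"
    and null: "\<And>A. A \<in> sets borel \<Longrightarrow> emeasure \<mu> A = 0 \<Longrightarrow> AE \<omega> in P. pt_count (N \<omega>) A = 0"
    and moment: "\<And>A B. A \<in> pos_finite_sets \<mu> \<Longrightarrow> B \<in> pos_finite_sets \<mu> \<Longrightarrow> A \<inter> B = {} \<Longrightarrow>
       second_moment P N A B = emeasure \<mu> A * emeasure \<mu> B"
    and R: "mp_bijection \<mu> R"
    and B: "B \<in> sets borel" "bounded B" "R ` B \<inter> B = {}"
  shows "AE \<omega> in P. \<forall>y \<in> N \<omega> \<inter> B. R y \<notin> N \<omega>"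
proof -
  have s: "sets \<mu> = sets borel" using bf by (simp add: boundedly_finite_def)
  have Bfin: "emeasure \<mu> B < \<infinity>" using bf B by (simp add: boundedly_finite_def)
  have bij: "bij R" and Rinv: "inv R \<in> borel_measurable borel"
    using R by (auto simp: mp_bijection_def)
  have img: "R ` A = inv R -` A" for A
    using bij by (simp add: bij_vimage_eq_inv_image bij_imp_bij_inv inv_inv_eq)
  have imgM: "R ` A \<in> sets borel" if "A \<in> sets borel" for A
    unfolding img by (rule borel_vimage[OF Rinv that])
  have imgE: "emeasure \<mu> (R ` A) = emeasure \<mu> A" if "A \<in> sets borel" for A
    using mp_bijection_inv[OF R] that unfolding img by (simp add: mp_bijection_def)
  \<comment> \<open>contains every \<open>\<omega>\<close> for which some \<open>y \<in> N \<omega> \<inter> A\<close> has \<open>R y \<in> N \<omega>\<close>\<close>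
  define G where "G A = {\<omega> \<in> space P. pt_count (N \<omega>) A \<ge> 1 \<and> pt_count (N \<omega>) (R ` A) \<ge> 1}" for A
  have cnt [measurable]: "(\<lambda>\<omega>. pt_count (N \<omega>) A) \<in> borel_measurable P" if "A \<in> sets borel" for A
    using measurable_compose[OF N measurable_pt_count[OF that]] .
  have G [measurable]: "G A \<in> sets P" if A: "A \<in> sets borel" for A
    unfolding G_def using cnt[OF A] cnt[OF imgM[OF A]] by measurable
  have le: "emeasure P (G A) \<le> emeasure \<mu> A * emeasure \<mu> A" if A: "A \<in> sets borel" "A \<subseteq> B" for A
  proof (cases "emeasure \<mu> A = 0")
    case True
    have "AE \<omega> in P. \<omega> \<notin> G A" using null[OF A(1) True] by eventually_elim (simp add: G_def)
    then have "emeasure P (G A) = 0" using G[OF A(1)] by (simp add: AE_iff_measurable[of _ P] G_def)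
    then show ?thesis by simp
  next
    case False
    have "emeasure \<mu> A \<le> emeasure \<mu> B" using A B s by (intro emeasure_mono) auto
    then have "A \<in> pos_finite_sets \<mu>" "R ` A \<in> pos_finite_sets \<mu>"
      using False A imgM imgE Bfin s by (auto simp: pos_finite_sets_def zero_less_iff_neq_zero)
    moreover have "A \<inter> R ` A = {}" using A(2) B(3) by blast
    ultimately have m: "second_moment P N A (R ` A) = emeasure \<mu> A * emeasure \<mu> A"
      using moment imgE[OF A(1)] by simp
    have "emeasure P (G A) = (\<integral>\<^sup>+ \<omega>. indicator (G A) \<omega> \<partial>P)" using G[OF A(1)] by simp
    also have "\<dots> \<le> second_moment P N A (R ` A)"
      unfolding second_moment_def
    proof (rule nn_integral_mono)
      fix \<omega>
      show "indicator (G A) \<omega> \<le> pt_count (N \<omega>) A * pt_count (N \<omega>) (R ` A)"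
        using mult_mono[of 1 "pt_count (N \<omega>) A" 1 "pt_count (N \<omega>) (R ` A)"]
        by (auto simp: indicator_def G_def)
    qed
    finally show ?thesis using m by simp
  qed
  \<comment> \<open>the exceptional event is only shown to be contained in measurable events of small probability, as
    its own measurability is not apparent\<close>
  have "\<exists>Z \<in> sets P. emeasure P Z \<le> ennreal (1 / real (Suc n)) * emeasure \<mu> B \<and>
      {\<omega> \<in> space P. \<not> (\<forall>y \<in> N \<omega> \<inter> B. R y \<notin> N \<omega>)} \<subseteq> Z" for n
  proof -
    let ?e = "ennreal (1 / real (Suc n))"
    have e: "0 < ?e" by simp
    from small_partition[OF bf atom e] obtain U :: "nat \<Rightarrow> 'a set" where
      U: "\<And>i. U i \<in> sets borel" "\<And>i. emeasure \<mu> (U i) \<le> ?e" "disjoint_family U" "(\<Union>i. U i) = UNIV"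
      by blast
    define A where "A i = B \<inter> U i" for i :: nat
    have A: "A i \<in> sets borel" "A i \<subseteq> B" for i using U(1) B(1) by (auto simp: A_def)
    have Ae: "emeasure \<mu> (A i) \<le> ?e" for i
    proof -
      have "emeasure \<mu> (A i) \<le> emeasure \<mu> (U i)"
        by (rule emeasure_mono) (simp_all add: A_def s U(1))
      also have "\<dots> \<le> ?e" by (rule U(2))
      finally show ?thesis .
    qed
    have GA: "range (\<lambda>i. G (A i)) \<subseteq> sets P" using G[OF A(1)] by blast
    have "emeasure P (\<Union>i. G (A i)) \<le> (\<Sum>i. emeasure P (G (A i)))"
      by (rule emeasure_subadditive_countably[OF GA])
    also have "\<dots> \<le> (\<Sum>i. ?e * emeasure \<mu> (A i))"
    proof (rule suminf_le)
      show "emeasure P (G (A i)) \<le> ?e * emeasure \<mu> (A i)" for i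
        by (rule order_trans[OF le[OF A] mult_right_mono[OF Ae]]) simp
    qed simp_all
    also have "\<dots> = ?e * (\<Sum>i. emeasure \<mu> (A i))" by simp
    also have "(\<Sum>i. emeasure \<mu> (A i)) = emeasure \<mu> (\<Union>i. A i)"
    proof (rule suminf_emeasure)
      show "range A \<subseteq> sets \<mu>" unfolding s using A(1) by blast
      show "disjoint_family A"
        using U(3) unfolding disjoint_family_on_def A_def by blast
    qed
    also have "(\<Union>i. A i) = B" using U(4) by (auto simp: A_def)
    finally have "emeasure P (\<Union>i. G (A i)) \<le> ?e * emeasure \<mu> B" .
    moreover have "{\<omega> \<in> space P. \<not> (\<forall>y \<in> N \<omega> \<inter> B. R y \<notin> N \<omega>)} \<subseteq> (\<Union>i. G (A i))"
    proof
      fix \<omega> assume "\<omega> \<in> {\<omega> \<in> space P. \<not> (\<forall>y \<in> N \<omega> \<inter> B. R y \<notin> N \<omega>)}"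
      then obtain y where *: "\<omega> \<in> space P" "y \<in> N \<omega>" "y \<in> B" "R y \<in> N \<omega>" by blast
      obtain i where "y \<in> U i" using U(4) by blast
      with * have "N \<omega> \<inter> A i \<noteq> {}" "N \<omega> \<inter> R ` A i \<noteq> {}" by (auto simp: A_def)
      then show "\<omega> \<in> (\<Union>i. G (A i))" using * by (auto simp: G_def intro: one_le_pt_count)
    qed
    moreover have "(\<Union>i. G (A i)) \<in> sets P" using GA by (rule sets.countable_UN)
    ultimately show ?thesis by blast
  qed
  then have "\<forall>n. \<exists>Z. Z \<in> sets P \<and> emeasure P Z \<le> ennreal (1 / real (Suc n)) * emeasure \<mu> B \<and>
      {\<omega> \<in> space P. \<not> (\<forall>y \<in> N \<omega> \<inter> B. R y \<notin> N \<omega>)} \<subseteq> Z" by blast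
  from choice[OF this] obtain Z where Z: "\<And>n. Z n \<in> sets P"
    "\<And>n. emeasure P (Z n) \<le> ennreal (1 / real (Suc n)) * emeasure \<mu> B"
    "\<And>n. {\<omega> \<in> space P. \<not> (\<forall>y \<in> N \<omega> \<inter> B. R y \<notin> N \<omega>)} \<subseteq> Z n" by blast
  have "emeasure P (\<Inter>n. Z n) \<le> 0"
  proof (rule LIMSEQ_le_const)
    have "(\<lambda>n. ennreal (1 / real (Suc n))) \<longlonglongrightarrow> ennreal 0"
      using LIMSEQ_inverse_real_of_nat by (intro tendsto_ennrealI) (simp add: inverse_eq_divide)
    then show "(\<lambda>n. ennreal (1 / real (Suc n)) * emeasure \<mu> B) \<longlonglongrightarrow> 0"
      using tendsto_mult_ennreal[of _ 0 sequentially "\<lambda>_. emeasure \<mu> B" "emeasure \<mu> B"] Bfin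
      by simp
    have "emeasure P (\<Inter>n. Z n) \<le> emeasure P (Z n)" for n using Z by (intro emeasure_mono) auto
    then show "\<exists>m. \<forall>n\<ge>m. emeasure P (\<Inter>n. Z n) \<le> ennreal (1 / real (Suc n)) * emeasure \<mu> B"
      using Z(2) order_trans by blast
  qed
  then have "(\<Inter>n. Z n) \<in> null_sets P" using Z(1) by (auto intro!: null_setsI)
  then show ?thesis using Z(3) by (intro AE_I'[of "\<Inter>n. Z n"]) auto
qed

text \<open>Outside the null set of fixed points, \<open>y\<close> and \<open>R y\<close> are separated by disjoint open sets \<open>U\<close> and
\<open>V\<close> of a countable base. The complement of the fixed points is thus a countable union of bounded
sets \<open>B = U \<inter> R -` V \<inter> ball x0 n\<close> with \<open>R B \<inter> B = {}\<close>, to which the previous lemma applies.\<close>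

lemma no_points_on_graph:
  fixes \<mu> :: "'a::polish_space measure"
  assumes bf: "boundedly_finite \<mu>" and atom: "\<And>x. emeasure \<mu> {x} = 0"
    and N: "N \<in> measurable P Astar"
    and null: "\<And>A. A \<in> sets borel \<Longrightarrow> emeasure \<mu> A = 0 \<Longrightarrow> AE \<omega> in P. pt_count (N \<omega>) A = 0"
    and moment: "\<And>A B. A \<in> pos_finite_sets \<mu> \<Longrightarrow> B \<in> pos_finite_sets \<mu> \<Longrightarrow> A \<inter> B = {} \<Longrightarrow>
       second_moment P N A B = emeasure \<mu> A * emeasure \<mu> B"
    and R: "mp_bijection \<mu> R" and fixp: "emeasure \<mu> {x. R x = x} = 0"
  shows "AE \<omega> in P. N \<omega> \<inter> R ` N \<omega> = {}"
proof -
  have Rm: "R \<in> borel_measurable borel" using R by (simp add: mp_bijection_def)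
  define x0 :: 'a where "x0 = undefined"
  obtain \<B> :: "'a set set" where \<B>: "countable \<B>" "topological_basis \<B>"
    using ex_countable_basis by blast
  define \<D> where "\<D> = {(U, V) \<in> \<B> \<times> \<B>. U \<inter> V = {}}"
  have \<D>: "countable \<D>" unfolding \<D>_def using \<B>(1)
    by (intro countable_subset[OF _ countable_SIGMA[of \<B> "\<lambda>_. \<B>"]]) auto
  define B where "B p n = fst p \<inter> R -` snd p \<inter> ball x0 (real n)" for p :: "'a set \<times> 'a set" and n :: nat
  have "AE \<omega> in P. \<forall>y \<in> N \<omega> \<inter> B p n. R y \<notin> N \<omega>" if "p \<in> \<D>" for p n
  proof -
    from that obtain U V where p: "p = (U, V)" "U \<in> \<B>" "V \<in> \<B>" "U \<inter> V = {}" by (auto simp: \<D>_def)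
    have "U \<in> sets borel" "V \<in> sets borel" using p \<B>(2) by (auto dest: topological_basis_open)
    then show ?thesis
      using p(4) borel_vimage[OF Rm, of V]
      by (intro no_points_on_graph_piece[OF bf atom N null moment R])
         (auto simp: B_def p(1) bounded_Int)
  qed
  then have "AE \<omega> in P. \<forall>n::nat. \<forall>y \<in> N \<omega> \<inter> B p n. R y \<notin> N \<omega>" if "p \<in> \<D>" for p
    using that by (subst AE_all_countable) blast
  then have "AE \<omega> in P. \<forall>p\<in>\<D>. \<forall>n::nat. \<forall>y \<in> N \<omega> \<inter> B p n. R y \<notin> N \<omega>"
    by (subst AE_ball_countable[OF \<D>]) blast
  moreover have "AE \<omega> in P. pt_count (N \<omega>) {x. R x = x} = 0"
    by (rule null[OF fixed_points_measurable[OF Rm] fixp])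
  ultimately show ?thesis
  proof eventually_elim
    case (elim \<omega>)
    have False if y: "y \<in> N \<omega>" "R y \<in> N \<omega>" for y
    proof -
      have "R y \<noteq> y" using elim(2) y(1) by (auto simp: pt_count_eq_0_iff)
      then obtain U' V' where "open U'" "open V'" "y \<in> U'" "R y \<in> V'" "U' \<inter> V' = {}"
        using hausdorff[of y "R y"] by metis
      moreover obtain U where "U \<in> \<B>" "y \<in> U" "U \<subseteq> U'"
        using topological_basisE[OF \<B>(2) \<open>open U'\<close> \<open>y \<in> U'\<close>] by metis
      moreover obtain V where "V \<in> \<B>" "R y \<in> V" "V \<subseteq> V'"
        using topological_basisE[OF \<B>(2) \<open>open V'\<close> \<open>R y \<in> V'\<close>] by metis
      ultimately have UV: "(U, V) \<in> \<D>" "y \<in> U" "R y \<in> V" by (auto simp: \<D>_def)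
      obtain n :: nat where "dist x0 y < real n" using reals_Archimedean2 by blast
      then have "y \<in> B (U, V) n" using UV by (simp add: B_def)
      then show False using elim(1) UV(1) y by blast
    qed
    then show ?case by blast
  qed
qed

section \<open>Freeness from the second moment\<close>

text \<open>The inverse preserves the measure too: since \<open>P\<close> is its own image under \<open>S\<close>, its image
under \<open>S'\<close> is the one under \<open>S' \<circ> S\<close>, which is the identity almost everywhere.\<close>

lemma prob_automorphism_distr:
  assumes "prob_automorphism P S S'"
  shows "S \<in> measurable P P" "S' \<in> measurable P P" "distr P P S = P" "distr P P S' = P"
proof -
  show m: "S \<in> measurable P P" "S' \<in> measurable P P" and d: "distr P P S = P"
    using assms by (auto simp: prob_automorphism_def measure_preserving_map_def)
  have ae: "AE \<omega> in P. S' (S \<omega>) = \<omega>" using assms by (simp add: prob_automorphism_def)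
  have "distr P P S' = distr (distr P P S) P S'" by (simp add: d)
  also have "\<dots> = distr P P (S' \<circ> S)" using m by (simp add: distr_distr)
  also have "\<dots> = distr P P (\<lambda>\<omega>. \<omega>)"
    using ae m by (intro distr_cong_AE) auto
  finally show "distr P P S' = P" by simp
qed

lemma AE_measure_preserving:
  assumes S: "S \<in> measurable P P" "distr P P S = P" and Q: "AE \<omega> in P. Q \<omega>"
  shows "AE \<omega> in P. Q (S \<omega>)"
proof (rule AE_distrD[OF S(1)])
  show "AE \<omega> in distr P P S. Q \<omega>" using Q by (simp only: S(2))
qed

text \<open>Equivariance tested on singletons gives \<open>N(S \<omega>) = T N(\<omega>)\<close> almost surely. Measure preservation
allows \<open>\<omega>\<close> to be replaced by \<open>S' \<omega>\<close> or by an iterate in such a statement.\<close>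

lemma config_of_int_iterate:
  assumes pp: "T_point_process \<mu> T P S S' N" and T: "bij T"
  shows "AE \<omega> in P. N (int_iterate S S' k \<omega>) = int_iterate T (inv T) k ` N \<omega>"
proof -
  have aut: "prob_automorphism P S S'"
    and eqv: "AE \<omega> in P. \<forall>A \<in> sets borel. pt_count (N (S \<omega>)) A = pt_count (N \<omega>) (T -` A)"
    using pp by (auto simp: T_point_process_def)
  note D = prob_automorphism_distr[OF aut]
  have step: "AE \<omega> in P. N (S \<omega>) = T ` N \<omega>"
    using eqv
  proof eventually_elim
    case (elim \<omega>)
    have "x \<in> N (S \<omega>) \<longleftrightarrow> x \<in> T ` N \<omega>" for x
    proof -
      have "pt_count (N (S \<omega>)) {x} = pt_count (T ` N \<omega>) {x}"
        using elim by (simp add: pt_count_image[OF T])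
      then show ?thesis by (metis pt_count_singleton_eq_0_iff)
    qed
    then show ?case by blast
  qed
  have step': "AE \<omega> in P. N (S' \<omega>) = inv T ` N \<omega>"
  proof -
    have "AE \<omega> in P. S (S' \<omega>) = \<omega>" using aut by (simp add: prob_automorphism_def)
    with AE_measure_preserving[OF D(2,4) step] show ?thesis
    proof eventually_elim
      case (elim \<omega>)
      then show ?case using T by (simp add: image_image bij_is_inj)
    qed
  qed
  have iter: "AE \<omega> in P. N ((F ^^ n) \<omega>) = (f ^^ n) ` N \<omega>"
    if F: "F \<in> measurable P P" "distr P P F = P" and st: "AE \<omega> in P. N (F \<omega>) = f ` N \<omega>"
    for F f and n :: nat
  proof (induction n)
    case (Suc n)
    from AE_measure_preserving[OF F Suc] st show ?case
      by eventually_elim (simp add: funpow_Suc_right image_comp del: funpow.simps)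
  qed simp
  show ?thesis
    using iter[OF D(1,3) step] iter[OF D(2,4) step'] by (simp add: int_iterate_def)
qed

text \<open>The common points of \<open>N(\<omega>)\<close> and \<open>N(S\<^sup>k \<omega>) = T\<^sup>k N(\<omega>)\<close> correspond to the pairs of points of
\<open>N(\<omega>)\<close> on the graph of \<open>T\<^sup>k\<close>. As only countably many \<open>k\<close> occur, each can be treated separately.\<close>

theorem free_if_poisson_second_moment:
  fixes \<mu> :: "'a::polish_space measure"
  assumes sys: "infinite_mp_system \<mu> T" and pp: "T_point_process \<mu> T P S S' N"
    and moment: "\<And>A B. A \<in> pos_finite_sets \<mu> \<Longrightarrow> B \<in> pos_finite_sets \<mu> \<Longrightarrow> A \<inter> B = {} \<Longrightarrow>
       second_moment P N A B = emeasure \<mu> A * emeasure \<mu> B"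
  shows "free_T_point_process \<mu> T P S S' N"
proof -
  note I = infinite_mp_systemD[OF sys]
  have T: "bij T" using I(6) by (simp add: mp_bijection_def)
  have N: "N \<in> measurable P Astar"
    and null: "\<And>A. A \<in> sets borel \<Longrightarrow> emeasure \<mu> A = 0 \<Longrightarrow> AE \<omega> in P. pt_count (N \<omega>) A = 0"
    using pp by (auto simp: T_point_process_def)
  have "AE \<omega> in P. k \<noteq> 0 \<longrightarrow> N \<omega> \<inter> N (int_iterate S S' k \<omega>) = {}" for k :: int
  proof (cases "k = 0")
    case False
    have "AE \<omega> in P. N \<omega> \<inter> int_iterate T (inv T) k ` N \<omega> = {}"
      by (rule no_points_on_graph[OF I(3) atomless[OF sys] N null moment
            mp_bijection_int_iterate[OF I(6)] int_iterate_fixed_points_null[OF sys False]])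
    with config_of_int_iterate[OF pp T, of k] show ?thesis by eventually_elim simp
  qed simp
  then show ?thesis using pp by (simp add: free_T_point_process_def AE_all_countable)
qed

section \<open>Moments of the Poisson law\<close>

text \<open>The term of index \<open>n + 1\<close> of the series for the mean is \<open>r\<close> times the probability of \<open>n\<close>.\<close>

lemma poisson_mean:
  assumes r: "0 < r"
  shows "(\<integral>\<^sup>+ n. of_nat n \<partial>measure_pmf (poisson_pmf r)) = ennreal r"
proof -
  have "(\<lambda>n. r ^ n / fact n) sums exp r"
    using exp_converges[of r] by (simp add: divide_inverse mult.commute)
  from sums_mult[OF this, of "exp (- r) * r"]
  have "(\<lambda>n. exp (- r) * r * (r ^ n / fact n)) sums r"
    by (simp add: exp_minus field_simps)
  moreover have "exp (- r) * r * (r ^ n / fact n) = pmf (poisson_pmf r) (Suc n) * real (Suc n)" for n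
    using r by (simp add: field_simps del: of_nat_Suc)
  ultimately have "(\<lambda>n. pmf (poisson_pmf r) (Suc n) * real (Suc n)) sums r" by simp
  then have s: "(\<lambda>n. pmf (poisson_pmf r) n * real n) sums r"
    using sums_Suc_iff[of "\<lambda>n. pmf (poisson_pmf r) n * real n" r] by simp
  have "(\<integral>\<^sup>+ n. of_nat n \<partial>measure_pmf (poisson_pmf r)) = (\<Sum>n. ennreal (pmf (poisson_pmf r) n) * of_nat n)"
    by (simp add: nn_integral_measure_pmf nn_integral_count_space_nat)
  also have "\<dots> = (\<Sum>n. ennreal (pmf (poisson_pmf r) n * real n))"
    by (simp add: ennreal_mult ennreal_of_nat_eq_real_of_nat)
  also have "\<dots> = ennreal r"
    using s r by (intro sums_unique[symmetric]) simp
  finally show ?thesis .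
qed

lemma poisson_lawD:
  assumes "poisson_law \<mu> Q"
  shows "prob_space Q" "space Q = Xstar" "sets Q = sets Astar"
    "\<And>A. A \<in> pos_finite_sets \<mu> \<Longrightarrow> distr Q borel (\<lambda>\<xi>. pt_count \<xi> A) =
        distr (measure_pmf (poisson_pmf (measure \<mu> A))) borel of_nat"
    "\<And>(k::nat) A. (\<And>i. i < k \<Longrightarrow> A i \<in> pos_finite_sets \<mu>) \<Longrightarrow> disjoint_family_on A {..<k} \<Longrightarrow>
        prob_space.indep_vars Q (\<lambda>_. borel) (\<lambda>i \<xi>. pt_count \<xi> (A i)) {..<k}"
  using assms by (auto simp: poisson_law_def)

lemma measurable_pt_count_law:
  assumes "sets Q = sets Astar" "A \<in> sets borel"
  shows "(\<lambda>\<xi>. pt_count \<xi> A) \<in> borel_measurable Q"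
  using measurable_pt_count[OF assms(2)] measurable_cong_sets[OF assms(1) refl] by blast

lemma poisson_law_mean:
  fixes \<mu> :: "'a::polish_space measure"
  assumes Q: "poisson_law \<mu> Q" and s: "sets \<mu> = sets borel" and A: "A \<in> pos_finite_sets \<mu>"
  shows "(\<integral>\<^sup>+ \<xi>. pt_count \<xi> A \<partial>Q) = emeasure \<mu> A"
proof -
  have A': "A \<in> sets borel" "0 < measure \<mu> A" "emeasure \<mu> A = ennreal (measure \<mu> A)"
    using A s by (auto simp: pos_finite_sets_def measure_def enn2real_positive_iff less_top)
  have "(\<integral>\<^sup>+ \<xi>. pt_count \<xi> A \<partial>Q) = (\<integral>\<^sup>+ t. t \<partial>distr Q borel (\<lambda>\<xi>. pt_count \<xi> A))"
    by (simp add: nn_integral_distr measurable_pt_count_law[OF poisson_lawD(3)[OF Q] A'(1)])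
  also have "\<dots> = (\<integral>\<^sup>+ n. of_nat n \<partial>measure_pmf (poisson_pmf (measure \<mu> A)))"
    by (simp add: poisson_lawD(4)[OF Q A] nn_integral_distr)
  finally show ?thesis using poisson_mean[OF A'(2)] A'(3) by simp
qed

text \<open>The law prescribes the counts of sets of positive finite measure only. Adding a null set \<open>A\<close>
to a disjoint set \<open>C\<close> of positive finite measure does not change the expected count, so the
expected count of \<open>A\<close> vanishes.\<close>

lemma poisson_law_null:
  fixes \<mu> :: "'a::polish_space measure"
  assumes Q: "poisson_law \<mu> Q" and bf: "boundedly_finite \<mu>" and inf: "emeasure \<mu> UNIV = \<infinity>"
    and A: "A \<in> sets borel" "emeasure \<mu> A = 0"
  shows "AE \<xi> in Q. pt_count \<xi> A = 0"
proof -
  have s: "sets \<mu> = sets borel" using bf by (simp add: boundedly_finite_def)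
  define x0 :: 'a where "x0 = undefined"
  have "\<exists>n::nat. emeasure \<mu> (ball x0 (real n)) \<noteq> 0"
    using null_if_null_on_balls[OF s, of UNIV x0] inf by fastforce
  then obtain n :: nat where n: "emeasure \<mu> (ball x0 (real n)) \<noteq> 0" by blast
  define C where "C = ball x0 (real n) - A"
  have C: "C \<in> sets borel" using A(1) by (simp add: C_def)
  have "emeasure \<mu> C = emeasure \<mu> (ball x0 (real n))"
    unfolding C_def using A s by (intro emeasure_Diff_null_set) (auto intro!: null_setsI)
  moreover have "emeasure \<mu> (ball x0 (real n)) < \<infinity>" using bf by (simp add: boundedly_finite_def)
  ultimately have Cp: "C \<in> pos_finite_sets \<mu>" and Cf: "emeasure \<mu> C \<noteq> \<infinity>"
    using n C s by (auto simp: pos_finite_sets_def zero_less_iff_neq_zero)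
  have AC: "emeasure \<mu> (A \<union> C) = emeasure \<mu> C"
    using A C s by (subst Un_commute, intro emeasure_Un_null_set) (auto intro!: null_setsI)
  then have ACp: "A \<union> C \<in> pos_finite_sets \<mu>"
    using Cp A s by (auto simp: pos_finite_sets_def)
  note m = measurable_pt_count_law[OF poisson_lawD(3)[OF Q]]
  have "A \<inter> C = {}" by (auto simp: C_def)
  then have "emeasure \<mu> C = (\<integral>\<^sup>+ \<xi>. pt_count \<xi> A + pt_count \<xi> C \<partial>Q)"
    using poisson_law_mean[OF Q s ACp] AC by (simp add: pt_count_Un_disjoint)
  also have "\<dots> = (\<integral>\<^sup>+ \<xi>. pt_count \<xi> A \<partial>Q) + emeasure \<mu> C"
    using m[OF A(1)] m[OF C] by (simp add: nn_integral_add poisson_law_mean[OF Q s Cp])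
  finally have "(\<integral>\<^sup>+ \<xi>. pt_count \<xi> A \<partial>Q) = 0"
    using Cf ennreal_add_left_cancel[of "emeasure \<mu> C" 0 "\<integral>\<^sup>+ \<xi>. pt_count \<xi> A \<partial>Q"]
    by (simp add: add.commute)
  then show ?thesis using m[OF A(1)] by (simp add: nn_integral_0_iff_AE)
qed

lemma poisson_law_disjoint_moment:
  fixes \<mu> :: "'a::polish_space measure"
  assumes Q: "poisson_law \<mu> Q" and s: "sets \<mu> = sets borel"
    and A: "A \<in> pos_finite_sets \<mu>" and B: "B \<in> pos_finite_sets \<mu>" and disj: "A \<inter> B = {}"
  shows "second_moment Q (\<lambda>\<xi>. \<xi>) A B = emeasure \<mu> A * emeasure \<mu> B"
proof -
  interpret prob_space Q by (rule poisson_lawD(1)[OF Q])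
  let ?F = "\<lambda>i::nat. if i = 0 then A else B"
  have two: "{..<2} = {0, 1::nat}" by auto
  have "indep_vars (\<lambda>_. borel) (\<lambda>i \<xi>. pt_count \<xi> (?F i)) {..<2}"
    by (rule poisson_lawD(5)[OF Q]) (use A B disj in \<open>auto simp: disjoint_family_on_def\<close>)
  from indep_vars_nn_integral[OF _ this]
  have "(\<integral>\<^sup>+ \<xi>. pt_count \<xi> A * pt_count \<xi> B \<partial>Q) =
      (\<integral>\<^sup>+ \<xi>. pt_count \<xi> A \<partial>Q) * (\<integral>\<^sup>+ \<xi>. pt_count \<xi> B \<partial>Q)"
    by (simp add: two)
  then show ?thesis
    by (simp add: second_moment_def poisson_law_mean[OF Q s A] poisson_law_mean[OF Q s B])
qed

section \<open>Uniqueness of the Poisson law\<close>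

text \<open>The right-hand side depends on the measures of the \<open>D i\<close> only. This is the form in which
invariance of \<open>\<mu>\<close> will be turned into invariance of the law.\<close>

lemma poisson_law_fdd:
  fixes \<mu> :: "'a::polish_space measure"
  assumes Q: "poisson_law \<mu> Q" and s: "sets \<mu> = sets borel" and m: "0 < (m::nat)"
    and D: "\<And>i. i < m \<Longrightarrow> D i \<in> pos_finite_sets \<mu>" "disjoint_family_on D {..<m}"
  shows "distr Q (PiM {..<m} (\<lambda>_. borel)) (\<lambda>\<xi>. \<lambda>i\<in>{..<m}. pt_count \<xi> (D i)) =
    PiM {..<m} (\<lambda>i. distr (measure_pmf (poisson_pmf (measure \<mu> (D i)))) borel of_nat)"
proof -
  interpret prob_space Q by (rule poisson_lawD(1)[OF Q])
  have rv: "(\<lambda>\<xi>. pt_count \<xi> (D i)) \<in> borel_measurable Q" if "i \<in> {..<m}" for i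
    by (rule measurable_pt_count_law[OF poisson_lawD(3)[OF Q]])
      (use D(1)[of i] that s in \<open>auto simp: pos_finite_sets_def\<close>)
  have "{..<m} \<noteq> {}" using m by auto
  from indep_vars_iff_distr_eq_PiM'[where X = "\<lambda>i \<xi>. pt_count \<xi> (D i)" and M' = "\<lambda>_. borel", OF this rv]
    poisson_lawD(5)[OF Q D]
  have "distr Q (PiM {..<m} (\<lambda>_. borel)) (\<lambda>\<xi>. \<lambda>i\<in>{..<m}. pt_count \<xi> (D i)) =
      PiM {..<m} (\<lambda>i. distr Q borel (\<lambda>\<xi>. pt_count \<xi> (D i)))" by blast
  also have "\<dots> = PiM {..<m} (\<lambda>i. distr (measure_pmf (poisson_pmf (measure \<mu> (D i)))) borel of_nat)"
    by (intro PiM_cong refl poisson_lawD(4)[OF Q] D) simp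
  finally show ?thesis .
qed

text \<open>The algebra of sets generated by the family has finitely many atoms, and the \<open>D i\<close> are those that have positive
measure and lie in the union of the family. An atom is determined by the
members of the family to which its points belong. Up to a null set, each
member is the union of the atoms contained in it.\<close>

lemma finite_family_refinement:
  fixes \<mu> :: "'a::polish_space measure"
  assumes bf: "boundedly_finite \<mu>" and fin: "finite \<A>"
    and A: "\<And>A. A \<in> \<A> \<Longrightarrow> A \<in> sets borel \<and> bounded A"
  shows "\<exists>(m::nat) D. (\<forall>i<m. D i \<in> pos_finite_sets \<mu>) \<and> disjoint_family_on D {..<m} \<and>
     (\<forall>A\<in>\<A>. emeasure \<mu> (A - (\<Union>i\<in>{i. i < m \<and> D i \<subseteq> A}. D i)) = 0)"
proof -
  have s: "sets \<mu> = sets borel" using bf by (simp add: boundedly_finite_def)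
  \<comment> \<open>the empty \<open>J\<close> is excluded below: its atom, the complement of the union of the family, may have
    infinite measure\<close>
  define At where "At J = {x. {A \<in> \<A>. x \<in> A} = J}" for J
  define I where "I = {J \<in> Pow \<A> - {{}}. emeasure \<mu> (At J) \<noteq> 0}"
  have At: "At J \<in> sets borel" if "J \<subseteq> \<A>" for J
  proof -
    have "At J = {x \<in> space borel. \<forall>A\<in>\<A>. x \<in> A \<longleftrightarrow> A \<in> J}" using that by (auto simp: At_def)
    also have "\<dots> \<in> sets borel"
    proof (rule sets.sets_Collect_finite_All[OF _ fin])
      fix A assume "A \<in> \<A>"
      then have "A \<in> sets borel" "- A \<in> sets borel" using A borel_comp by auto
      moreover have "{x \<in> space borel. x \<in> A \<longleftrightarrow> A \<in> J} = (if A \<in> J then A else - A)" by auto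
      ultimately show "{x \<in> space borel. x \<in> A \<longleftrightarrow> A \<in> J} \<in> sets borel" by simp
    qed
    finally show ?thesis .
  qed
  have At_fin: "emeasure \<mu> (At J) < \<infinity>" if J: "J \<in> Pow \<A> - {{}}" for J
  proof -
    obtain A0 where A0: "A0 \<in> J" "A0 \<in> \<A>" using J by blast
    then have "At J \<subseteq> A0" by (auto simp: At_def)
    moreover have "At J \<in> sets borel" using At that by blast
    ultimately show ?thesis
      using A[OF A0(2)] bf by (meson boundedly_finite_def bounded_subset)
  qed
  have "finite I" using fin by (simp add: I_def)
  then obtain h where h: "bij_betw h {0..<card I} I" using ex_bij_betw_nat_finite by blast
  define m where "m = card I"
  have hI: "h i \<in> I" if "i < m" for i using h that by (auto simp: bij_betw_def m_def)
  show ?thesis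
  proof (intro exI[of _ m] exI[of _ "\<lambda>i. At (h i)"] conjI allI impI ballI)
    fix i assume "i < m"
    from hI[OF this] show "At (h i) \<in> pos_finite_sets \<mu>"
      using At[of "h i"] At_fin[of "h i"] s by (auto simp: I_def pos_finite_sets_def zero_less_iff_neq_zero)
  next
    have "h i \<noteq> h j" if "i < m" "j < m" "i \<noteq> j" for i j
      using h that by (auto simp: bij_betw_def m_def inj_on_def)
    moreover have "At J \<inter> At K = {}" if "J \<noteq> K" for J K using that by (auto simp: At_def)
    ultimately show "disjoint_family_on (\<lambda>i. At (h i)) {..<m}"
      by (simp add: disjoint_family_on_def)
  next
    fix A0 assume A0: "A0 \<in> \<A>"
    let ?N = "\<Union>J\<in>{J \<in> Pow \<A> - {{}}. emeasure \<mu> (At J) = 0}. At J"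
    have sub: "A0 - (\<Union>i\<in>{i. i < m \<and> At (h i) \<subseteq> A0}. At (h i)) \<subseteq> ?N"
    proof
      fix x assume x: "x \<in> A0 - (\<Union>i\<in>{i. i < m \<and> At (h i) \<subseteq> A0}. At (h i))"
      define J where "J = {A \<in> \<A>. x \<in> A}"
      have J: "J \<in> Pow \<A> - {{}}" "x \<in> At J" "At J \<subseteq> A0" using x A0 by (auto simp: J_def At_def)
      have "J \<notin> I"
      proof
        assume "J \<in> I"
        then have "J \<in> h ` {0..<m}" using h by (simp add: bij_betw_def m_def)
        then obtain i where "i < m" "h i = J" by auto
        then show False using x J by blast
      qed
      then show "x \<in> ?N" using J by (auto simp: I_def)
    qed
    have N0: "emeasure \<mu> ?N = 0"
    proof -
      have "(\<Union>J\<in>{J \<in> Pow \<A> - {{}}. emeasure \<mu> (At J) = 0}. At J) \<in> null_sets \<mu>"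
        using fin At s by (intro null_sets_UN' countable_finite) (auto intro!: null_setsI)
      then show ?thesis by auto
    qed
    have NM: "?N \<in> sets \<mu>"
      unfolding s using fin At by (intro sets.finite_UN) auto
    show "emeasure \<mu> (A0 - (\<Union>i\<in>{i. i < m \<and> At (h i) \<subseteq> A0}. At (h i))) = 0"
      using emeasure_mono[OF sub NM] by (simp only: N0 le_zero_eq)
  qed
qed

text \<open>The cylinder sets \<open>{\<xi>. \<xi>(A) \<in> C for all (A, C) \<in> F}\<close>, with \<open>F\<close> finite, form a generator that is stable under
intersection. The counts of the sets occurring in \<open>F\<close> are almost surely sums of counts of disjoint sets of
positive finite measure, so that the joint laws of the latter determine the probabilities of all
cylinder sets.\<close>

lemma config_law_unique:
  fixes \<mu> :: "'a::polish_space measure"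
  assumes bf: "boundedly_finite \<mu>"
    and Q: "prob_space Q" "sets Q = sets Astar" and Q': "prob_space Q'" "sets Q' = sets Astar"
    and null: "\<And>A. A \<in> sets borel \<Longrightarrow> emeasure \<mu> A = 0 \<Longrightarrow> AE \<xi> in Q. pt_count \<xi> A = 0"
    and null': "\<And>A. A \<in> sets borel \<Longrightarrow> emeasure \<mu> A = 0 \<Longrightarrow> AE \<xi> in Q'. pt_count \<xi> A = 0"
    and fdd: "\<And>(m::nat) D. 0 < m \<Longrightarrow> (\<And>i. i < m \<Longrightarrow> D i \<in> pos_finite_sets \<mu>) \<Longrightarrow>
      disjoint_family_on D {..<m} \<Longrightarrow>
      distr Q (PiM {..<m} (\<lambda>_. borel)) (\<lambda>\<xi>. \<lambda>i\<in>{..<m}. pt_count \<xi> (D i)) =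
      distr Q' (PiM {..<m} (\<lambda>_. borel)) (\<lambda>\<xi>. \<lambda>i\<in>{..<m}. pt_count \<xi> (D i))"
  shows "Q = Q'"
proof -
  have s: "sets \<mu> = sets borel" using bf by (simp add: boundedly_finite_def)
  define \<G> :: "('a set \<times> ennreal set) set" where
    "\<G> = {(A, C). A \<in> sets borel \<and> bounded A \<and> C \<in> sets borel}"
  define cyl :: "('a set \<times> ennreal set) set \<Rightarrow> 'a set set" where
    "cyl F = {\<xi> \<in> Xstar. \<forall>(A, C)\<in>F. pt_count \<xi> A \<in> C}" for F
  define E where "E = {cyl F | F. finite F \<and> F \<subseteq> \<G>}"
  have cyl_sets: "cyl F \<in> sets Astar" if F: "finite F" "F \<subseteq> \<G>" for F
  proof -
    have "{\<xi> \<in> space Astar. \<forall>p\<in>F. pt_count \<xi> (fst p) \<in> snd p} \<in> sets Astar"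
    proof (rule sets.sets_Collect_finite_All[OF _ F(1)])
      fix p assume "p \<in> F"
      then have "fst p \<in> sets borel" "snd p \<in> sets borel" using F(2) by (auto simp: \<G>_def)
      from measurable_sets[OF measurable_pt_count[OF this(1)] this(2)]
      show "{\<xi> \<in> space Astar. pt_count \<xi> (fst p) \<in> snd p} \<in> sets Astar"
        by (simp add: vimage_def Int_def conj_commute)
    qed
    then show ?thesis by (simp add: cyl_def case_prod_unfold)
  qed
  have sig: "sets (Astar :: 'a set measure) = sigma_sets Xstar E"
  proof -
    have "sets (Astar :: 'a set measure) = sigma_sets Xstar
       {(\<lambda>\<xi>. pt_count \<xi> A) -` C \<inter> Xstar | A C. A \<in> sets borel \<and> bounded A \<and> C \<in> sets borel}"
      (is "_ = sigma_sets _ ?G") unfolding Astar_def by (rule sets_measure_of) auto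
    also have "\<dots> = sigma_sets Xstar E"
    proof (rule sigma_sets_eqI)
      fix a assume "a \<in> ?G"
      then obtain A C where AC: "a = (\<lambda>\<xi>. pt_count \<xi> A) -` C \<inter> Xstar" "(A, C) \<in> \<G>"
        by (auto simp: \<G>_def)
      have "a = cyl {(A, C)}" by (auto simp: AC cyl_def)
      then have "a \<in> E" using AC(2) unfolding E_def by blast
      then show "a \<in> sigma_sets Xstar E" by blast
    next
      fix b assume "b \<in> E"
      then show "b \<in> sigma_sets Xstar ?G"
        using cyl_sets \<open>sets Astar = sigma_sets Xstar ?G\<close> by (auto simp: E_def)
    qed
    finally show ?thesis .
  qed
  have eq: "emeasure Q X = emeasure Q' X" if X: "X \<in> E" for X
  proof -
    obtain F where F: "X = cyl F" "finite F" "F \<subseteq> \<G>" using X by (auto simp: E_def)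
    have fA: "finite (fst ` F)" "\<And>A. A \<in> fst ` F \<Longrightarrow> A \<in> sets borel \<and> bounded A"
      using F by (auto simp: \<G>_def)
    from finite_family_refinement[OF bf fA] obtain m :: nat and D where
      D: "\<forall>i<m. D i \<in> pos_finite_sets \<mu>" "disjoint_family_on D {..<m}"
      and rest: "\<forall>A\<in>fst ` F. emeasure \<mu> (A - (\<Union>i\<in>{i. i < m \<and> D i \<subseteq> A}. D i)) = 0"
      by blast
    have Db: "D i \<in> sets borel" if "i < m" for i using D(1) that s by (auto simp: pos_finite_sets_def)
    let ?M = "PiM {..<m} (\<lambda>_. borel :: ennreal measure)"
    let ?v = "\<lambda>\<xi>. \<lambda>i\<in>{..<m}. pt_count \<xi> (D i)"
    \<comment> \<open>the cylinder condition, expressed through the counts \<open>f i\<close> of the atoms \<open>D i\<close>\<close>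
    define Z where "Z = {f \<in> space ?M. \<forall>p\<in>F. (\<Sum>i\<in>{i. i < m \<and> D i \<subseteq> fst p}. f i) \<in> snd p}"
    have Z: "Z \<in> sets ?M"
      unfolding Z_def
    proof (rule sets.sets_Collect_finite_All[OF _ F(2)])
      fix p assume "p \<in> F"
      then have C: "snd p \<in> sets borel" using F(3) by (auto simp: \<G>_def)
      have "(\<lambda>f. \<Sum>i\<in>{i. i < m \<and> D i \<subseteq> fst p}. f i) \<in> borel_measurable ?M"
        by (intro borel_measurable_sum measurable_component_singleton) auto
      from measurable_sets[OF this C]
      show "{f \<in> space ?M. (\<Sum>i\<in>{i. i < m \<and> D i \<subseteq> fst p}. f i) \<in> snd p} \<in> sets ?M"
        by (simp add: vimage_def Int_def conj_commute)
    qed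
    have main: "emeasure R X = emeasure (distr R ?M ?v) Z"
      if R: "sets R = sets Astar"
        and nR: "\<And>A. A \<in> sets borel \<Longrightarrow> emeasure \<mu> A = 0 \<Longrightarrow> AE \<xi> in R. pt_count \<xi> A = 0" for R
    proof -
      have sp: "space R = Xstar" using sets_eq_imp_space_eq[OF R] by simp
      have v: "?v \<in> measurable R ?M"
        by (intro measurable_restrict measurable_pt_count_law[OF R] Db) simp
      have "AE \<xi> in R. \<forall>A\<in>fst ` F. pt_count \<xi> (A - (\<Union>i\<in>{i. i < m \<and> D i \<subseteq> A}. D i)) = 0"
      proof (subst AE_ball_countable[OF countable_finite[OF fA(1)]], intro ballI nR)
        fix A assume A: "A \<in> fst ` F"
        show "emeasure \<mu> (A - (\<Union>i\<in>{i. i < m \<and> D i \<subseteq> A}. D i)) = 0" using rest A by blast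
        show "A - (\<Union>i\<in>{i. i < m \<and> D i \<subseteq> A}. D i) \<in> sets borel"
          using fA(2)[OF A] Db by (intro sets.Diff sets.finite_UN) auto
      qed
      then have "AE \<xi> in R. \<xi> \<in> X \<longleftrightarrow> \<xi> \<in> ?v -` Z \<inter> space R"
        using AE_space
      proof eventually_elim
        case (elim \<xi>)
        have "pt_count \<xi> (fst p) = (\<Sum>i\<in>{i. i < m \<and> D i \<subseteq> fst p}. ?v \<xi> i)" if p: "p \<in> F" for p
        proof -
          let ?U = "\<Union>i\<in>{i. i < m \<and> D i \<subseteq> fst p}. D i"
          have dec: "fst p = ?U \<union> (fst p - ?U)" by blast
          have "pt_count \<xi> (fst p) = pt_count \<xi> ?U + pt_count \<xi> (fst p - ?U)"
            by (subst dec, rule pt_count_Un_disjoint) blast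
          also have "pt_count \<xi> (fst p - ?U) = 0" using elim(1) p by blast
          also have "pt_count \<xi> ?U = (\<Sum>i\<in>{i. i < m \<and> D i \<subseteq> fst p}. pt_count \<xi> (D i))"
            by (rule pt_count_UN_disjoint) (use D(2) in \<open>auto simp: disjoint_family_on_def\<close>)
          finally show ?thesis by simp
        qed
        then show ?case
          using elim(2) measurable_space[OF v elim(2)]
          by (simp add: F(1) cyl_def Z_def sp case_prod_unfold)
      qed
      then have "emeasure R X = emeasure R (?v -` Z \<inter> space R)"
        using cyl_sets[OF F(2,3)] measurable_sets[OF v Z] F(1) R by (intro emeasure_eq_AE) auto
      then show ?thesis by (simp add: emeasure_distr[OF v Z])
    qed
    have "distr Q ?M ?v = distr Q' ?M ?v"
    \<comment> \<open>\<open>m = 0\<close> occurs if all sets in \<open>F\<close> are null; the empty vector has a trivial law\<close>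
    proof (cases "m = 0")
      case True
      then have "?v = (\<lambda>\<xi>. \<lambda>_. undefined)" by (auto simp: restrict_def)
      then show ?thesis using True
        by (simp add: prob_space.distr_const[OF Q(1)] prob_space.distr_const[OF Q'(1)] space_PiM)
    next
      case False
      then show ?thesis using D by (intro fdd) auto
    qed
    then show ?thesis using main[OF Q(2) null] main[OF Q'(2) null'] by simp
  qed
  show ?thesis
  proof (rule measure_eqI_generator_eq[of E Xstar Q Q' "\<lambda>_. Xstar"])
    show "Int_stable E"
    proof (rule Int_stableI)
      fix a b assume "a \<in> E" "b \<in> E"
      then obtain F F' where F: "a = cyl F" "finite F" "F \<subseteq> \<G>" "b = cyl F'" "finite F'" "F' \<subseteq> \<G>"
        unfolding E_def by blast
      have "a \<inter> b = cyl (F \<union> F')" by (auto simp: F cyl_def)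
      moreover have "finite (F \<union> F')" "F \<union> F' \<subseteq> \<G>" using F by auto
      ultimately show "a \<inter> b \<in> E" unfolding E_def by blast
    qed
    show "E \<subseteq> Pow Xstar" by (auto simp: E_def cyl_def)
    show "emeasure Q X = emeasure Q' X" if "X \<in> E" for X by (rule eq[OF that])
    show "sets Q = sigma_sets Xstar E" "sets Q' = sigma_sets Xstar E" using sig Q Q' by auto
    have "Xstar = cyl {}" by (simp add: cyl_def)
    then show "range (\<lambda>_::nat. Xstar) \<subseteq> E" unfolding E_def by blast
    show "emeasure Q Xstar \<noteq> \<infinity>" for i :: nat
      using prob_space.finite_measure[OF Q(1)] finite_measure.emeasure_finite by auto
  qed simp
qed

section \<open>The Poisson suspension\<close>

lemma push_config_image: "T ` \<xi> \<in> Xstar \<Longrightarrow> push_config T \<xi> = T ` \<xi>"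
  by (simp add: push_config_def)

text \<open>The image of \<open>\<xi>\<close> is boundedly finite iff \<open>\<xi>\<close> has finitely many points in each of countably many
sets, namely the preimages of balls. On this measurable set the counts of the image are counts of \<open>\<xi>\<close>,
and elsewhere they vanish.\<close>

lemma measurable_push_config:
  fixes R :: "'a::polish_space \<Rightarrow> 'a"
  assumes bij: "bij R" and R: "R \<in> borel_measurable borel"
  shows "push_config R \<in> measurable Astar Astar"
proof -
  define x0 :: 'a where "x0 = undefined"
  let ?A = "Astar :: 'a set measure"
  have img: "R ` \<xi> \<in> Xstar \<longleftrightarrow> (\<forall>n::nat. pt_count \<xi> (R -` ball x0 (real n)) < \<infinity>)" for \<xi>
    unfolding in_Xstar_iff_balls[of _ x0] pt_count_image[OF bij] ..
  have cnt [measurable]: "(\<lambda>\<xi>. pt_count \<xi> (R -` A)) \<in> borel_measurable Astar" if "A \<in> sets borel" for A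
    by (rule measurable_pt_count[OF borel_vimage[OF R that]])
  have dom: "{\<xi> \<in> space ?A. R ` \<xi> \<in> Xstar} \<in> sets ?A"
    unfolding img using cnt[OF borel_open[OF open_ball]] by measurable
  have cases: "pt_count (push_config R \<xi>) A = (if R ` \<xi> \<in> Xstar then pt_count \<xi> (R -` A) else 0)" for \<xi> A
    by (simp add: push_config_def pt_count_image[OF bij]) (simp add: pt_count_def)
  have m: "(\<lambda>\<xi>. pt_count (push_config R \<xi>) A) \<in> borel_measurable Astar" if A: "A \<in> sets borel" for A
    unfolding cases by (intro measurable_If cnt[OF A] dom) simp
  have "push_config R \<in> measurable Astar (sigma Xstar
       {(\<lambda>\<xi>. pt_count \<xi> A) -` C \<inter> Xstar | A C. A \<in> sets borel \<and> bounded A \<and> C \<in> sets borel})"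
  proof (rule measurable_measure_of)
    have "{} \<in> (Xstar :: 'a set set)" by (simp add: Xstar_def)
    then show X: "push_config R \<in> space Astar \<rightarrow> Xstar" by (auto simp: push_config_def)
    fix y :: "'a set set"
    assume "y \<in> {(\<lambda>\<xi>. pt_count \<xi> A) -` C \<inter> Xstar | A C. A \<in> sets borel \<and> bounded A \<and> C \<in> sets borel}"
    then obtain A C where y: "y = (\<lambda>\<xi>. pt_count \<xi> A) -` C \<inter> Xstar" "A \<in> sets borel" "C \<in> sets borel"
      by blast
    have "push_config R -` y \<inter> space Astar = (\<lambda>\<xi>. pt_count (push_config R \<xi>) A) -` C \<inter> space Astar"
      unfolding y(1) using X by auto
    then show "push_config R -` y \<inter> space Astar \<in> sets Astar"
      using measurable_sets[OF m[OF y(2)] y(3)] by simp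
  qed auto
  then show ?thesis by (simp add: Astar_def)
qed

text \<open>The preimage of a ball has finite measure, even if it is unbounded, so its expected count is
finite.\<close>

lemma AE_image_in_Xstar:
  fixes \<mu> :: "'a::polish_space measure"
  assumes Q: "poisson_law \<mu> Q" and bf: "boundedly_finite \<mu>" and inf: "emeasure \<mu> UNIV = \<infinity>"
    and R: "mp_bijection \<mu> R"
  shows "AE \<xi> in Q. R ` \<xi> \<in> Xstar"
proof -
  have s: "sets \<mu> = sets borel" using bf by (simp add: boundedly_finite_def)
  have bij: "bij R" and Rm: "R \<in> borel_measurable borel"
    and pres: "\<And>A. A \<in> sets borel \<Longrightarrow> emeasure \<mu> (R -` A) = emeasure \<mu> A"
    using R by (auto simp: mp_bijection_def)
  define x0 :: 'a where "x0 = undefined"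
  have "AE \<xi> in Q. pt_count \<xi> (R -` ball x0 (real n)) < \<infinity>" for n :: nat
  proof -
    let ?B = "R -` ball x0 (real n)"
    have B: "?B \<in> sets borel" by (rule borel_vimage[OF Rm]) simp
    have fin: "emeasure \<mu> ?B < \<infinity>" using pres bf by (simp add: boundedly_finite_def)
    show ?thesis
    proof (cases "emeasure \<mu> ?B = 0")
      case True
      from poisson_law_null[OF Q bf inf B True] show ?thesis by eventually_elim simp
    next
      case False
      then have "?B \<in> pos_finite_sets \<mu>"
        using B fin s by (simp add: pos_finite_sets_def zero_less_iff_neq_zero)
      then have "(\<integral>\<^sup>+ \<xi>. pt_count \<xi> ?B \<partial>Q) \<noteq> \<infinity>"
        using poisson_law_mean[OF Q s] fin by simp
      from nn_integral_noteq_infinite[OF measurable_pt_count_law[OF poisson_lawD(3)[OF Q] B] this]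
      show ?thesis by (simp add: less_top)
    qed
  qed
  then have "AE \<xi> in Q. \<forall>n::nat. pt_count \<xi> (R -` ball x0 (real n)) < \<infinity>"
    by (subst AE_all_countable) blast
  then show ?thesis
    by (simp only: in_Xstar_iff_balls[of _ x0] pt_count_image[OF bij])
qed

text \<open>The counts of disjoint sets \<open>D i\<close> in the image configuration are the counts of the disjoint sets \<open>R -` D i\<close>,
which have the same measures, so they have the same joint law. By uniqueness, the image
law is the original one.\<close>

lemma push_config_preserves_poisson_law:
  fixes \<mu> :: "'a::polish_space measure"
  assumes Q: "poisson_law \<mu> Q" and bf: "boundedly_finite \<mu>" and inf: "emeasure \<mu> UNIV = \<infinity>"
    and R: "mp_bijection \<mu> R"
  shows "measure_preserving_map Q (push_config R)"
proof -
  have s: "sets \<mu> = sets borel" using bf by (simp add: boundedly_finite_def)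
  have bij: "bij R" and Rm: "R \<in> borel_measurable borel"
    and pres: "\<And>A. A \<in> sets borel \<Longrightarrow> emeasure \<mu> (R -` A) = emeasure \<mu> A"
    using R by (auto simp: mp_bijection_def)
  note L = poisson_lawD[OF Q]
  have push: "push_config R \<in> measurable Q Q"
    using measurable_push_config[OF bij Rm] measurable_cong_sets[OF L(3) L(3)] by blast
  have ae: "AE \<xi> in Q. \<forall>A. pt_count (push_config R \<xi>) A = pt_count \<xi> (R -` A)"
    using AE_image_in_Xstar[OF Q bf inf R]
    by eventually_elim (simp add: push_config_image pt_count_image[OF bij])
  have pre: "R -` A \<in> pos_finite_sets \<mu>" if "A \<in> pos_finite_sets \<mu>" for A
    using that borel_vimage[OF Rm, of A] pres[of A] s by (simp add: pos_finite_sets_def)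
  have "distr Q Q (push_config R) = Q"
  proof (rule config_law_unique[OF bf])
    show "prob_space Q" "sets Q = sets Astar" by (rule L)+
    show "prob_space (distr Q Q (push_config R))" by (rule prob_space.prob_space_distr[OF L(1) push])
    show "sets (distr Q Q (push_config R)) = sets Astar" using L(3) by simp
    fix A :: "'a set" assume A: "A \<in> sets borel" "emeasure \<mu> A = 0"
    show "AE \<xi> in Q. pt_count \<xi> A = 0" by (rule poisson_law_null[OF Q bf inf A])
    have "AE \<xi> in Q. pt_count \<xi> (R -` A) = 0"
      by (rule poisson_law_null[OF Q bf inf borel_vimage[OF Rm A(1)]]) (simp add: pres A)
    with ae have "AE \<xi> in Q. pt_count (push_config R \<xi>) A = 0" by eventually_elim simp
    moreover have "{\<xi> \<in> space Q. pt_count \<xi> A = 0} \<in> sets Q"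
      using measurable_sets[OF measurable_pt_count_law[OF L(3) A(1)], of "{0}"]
      by (simp add: vimage_def Int_def conj_commute)
    ultimately show "AE \<xi> in distr Q Q (push_config R). pt_count \<xi> A = 0"
      by (simp add: AE_distr_iff[OF push])
  next
    fix m :: nat and D
    assume m: "0 < m" and D: "\<And>i. i < m \<Longrightarrow> D i \<in> pos_finite_sets \<mu>" "disjoint_family_on D {..<m}"
    let ?M = "PiM {..<m} (\<lambda>_. borel :: ennreal measure)"
    have Db: "D i \<in> sets borel" if "i < m" for i using D(1)[OF that] s by (simp add: pos_finite_sets_def)
    have v: "(\<lambda>\<xi>. \<lambda>i\<in>{..<m}. pt_count \<xi> (D i)) \<in> measurable Q ?M"
      by (intro measurable_restrict measurable_pt_count_law[OF L(3)] Db) simp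
    have w: "(\<lambda>\<xi>. \<lambda>i\<in>{..<m}. pt_count \<xi> (R -` D i)) \<in> measurable Q ?M"
      by (intro measurable_restrict measurable_pt_count_law[OF L(3)] borel_vimage[OF Rm] Db) simp
    have pD: "\<And>i. i < m \<Longrightarrow> R -` D i \<in> pos_finite_sets \<mu>" using D(1) pre by blast
    have dD: "disjoint_family_on (\<lambda>i. R -` D i) {..<m}"
      using D(2) unfolding disjoint_family_on_def by (simp add: vimage_Int[symmetric])
    have "distr (distr Q Q (push_config R)) ?M (\<lambda>\<xi>. \<lambda>i\<in>{..<m}. pt_count \<xi> (D i)) =
        distr Q ?M (\<lambda>\<xi>. \<lambda>i\<in>{..<m}. pt_count (push_config R \<xi>) (D i))"
      by (simp add: distr_distr[OF v push] comp_def)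
    also have "\<dots> = distr Q ?M (\<lambda>\<xi>. \<lambda>i\<in>{..<m}. pt_count \<xi> (R -` D i))"
    proof (rule distr_cong_AE)
      show "AE \<xi> in Q. (\<lambda>i\<in>{..<m}. pt_count (push_config R \<xi>) (D i)) =
          (\<lambda>i\<in>{..<m}. pt_count \<xi> (R -` D i))"
        using ae by eventually_elim simp
      show "(\<lambda>\<xi>. \<lambda>i\<in>{..<m}. pt_count (push_config R \<xi>) (D i)) \<in> measurable Q ?M"
        using measurable_compose[OF push v] .
    qed (simp_all add: w)
    also have "\<dots> = PiM {..<m} (\<lambda>i. distr (measure_pmf (poisson_pmf (measure \<mu> (R -` D i)))) borel of_nat)"
      by (rule poisson_law_fdd[OF Q s m pD dD])
    also have "\<dots> = PiM {..<m} (\<lambda>i. distr (measure_pmf (poisson_pmf (measure \<mu> (D i)))) borel of_nat)"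
      by (rule PiM_cong) (simp_all add: measure_def pres Db)
    also have "\<dots> = distr Q ?M (\<lambda>\<xi>. \<lambda>i\<in>{..<m}. pt_count \<xi> (D i))"
      by (rule poisson_law_fdd[OF Q s m D, symmetric])
    finally show "distr (distr Q Q (push_config R)) ?M (\<lambda>\<xi>. \<lambda>i\<in>{..<m}. pt_count \<xi> (D i)) =
        distr Q ?M (\<lambda>\<xi>. \<lambda>i\<in>{..<m}. pt_count \<xi> (D i))" .
  qed
  then show ?thesis using push by (simp add: measure_preserving_map_def)
qed

lemma poisson_T_point_process:
  fixes \<mu> :: "'a::polish_space measure"
  assumes sys: "infinite_mp_system \<mu> T" and Q: "poisson_law \<mu> Q"
  shows "T_point_process \<mu> T Q (push_config T) (push_config (inv T)) (\<lambda>\<xi>. \<xi>)"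
proof -
  note I = infinite_mp_systemD[OF sys]
  note L = poisson_lawD[OF Q]
  note J = mp_bijection_inv[OF I(6)]
  have bij: "bij T" using I(6) by (simp add: mp_bijection_def)
  note X = AE_image_in_Xstar[OF Q I(3,5,6)] AE_image_in_Xstar[OF Q I(3,5) J]
  have "AE \<xi> in Q. push_config (inv T) (push_config T \<xi>) = \<xi>"
    using X(1) AE_space
  proof eventually_elim
    case (elim \<xi>)
    have "inv T ` T ` \<xi> = \<xi>" using bij by (simp add: image_image bij_is_inj)
    then show ?case using elim L(2) by (simp add: push_config_image)
  qed
  moreover have "AE \<xi> in Q. push_config T (push_config (inv T) \<xi>) = \<xi>"
    using X(2) AE_space
  proof eventually_elim
    case (elim \<xi>)
    have "T ` inv T ` \<xi> = \<xi>" using bij by (simp add: image_image bij_is_surj surj_f_inv_f)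
    then show ?case using elim L(2) by (simp add: push_config_image)
  qed
  moreover note push_config_preserves_poisson_law[OF Q I(3,5,6)]
    push_config_preserves_poisson_law[OF Q I(3,5) J]
  ultimately have "prob_automorphism Q (push_config T) (push_config (inv T))"
    using L(1) by (simp add: prob_automorphism_def measure_preserving_map_def)
  moreover have "(\<lambda>\<xi>. \<xi>) \<in> measurable Q Astar" using L(3) by (rule measurable_ident_sets)
  moreover have "AE \<xi> in Q. \<forall>A \<in> sets borel. pt_count (push_config T \<xi>) A = pt_count \<xi> (T -` A)"
    using X(1) by eventually_elim (simp add: push_config_image pt_count_image[OF bij])
  ultimately show ?thesis
    using poisson_law_null[OF Q I(3,5)] by (simp add: T_point_process_def)
qed

theorem proposition2p7:
  fixes \<mu> :: "'a::polish_space measure" and T :: "'a \<Rightarrow> 'a"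
  assumes "infinite_mp_system \<mu> T"
  shows "(\<forall>(P :: 'w measure) S S' N.
           T_point_process \<mu> T P S S' N \<and> square_integrable \<mu> P N \<and>
           (\<forall>A\<^sub>1 \<in> pos_finite_sets \<mu>. \<forall>A\<^sub>2 \<in> pos_finite_sets \<mu>.
              second_moment P N A\<^sub>1 A\<^sub>2 = emeasure \<mu> (A\<^sub>1 \<inter> A\<^sub>2) + emeasure \<mu> A\<^sub>1 * emeasure \<mu> A\<^sub>2)
           \<longrightarrow> free_T_point_process \<mu> T P S S' N) \<and>
         (\<forall>\<mu>star. poisson_law \<mu> \<mu>star \<longrightarrow>
           free_T_point_process \<mu> T \<mu>star (push_config T) (push_config (inv T)) (\<lambda>\<xi>. \<xi>))"
proof (intro conjI allI impI)
  fix P :: "'w measure" and S S' N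
  assume *: "T_point_process \<mu> T P S S' N \<and> square_integrable \<mu> P N \<and>
           (\<forall>A\<^sub>1 \<in> pos_finite_sets \<mu>. \<forall>A\<^sub>2 \<in> pos_finite_sets \<mu>.
              second_moment P N A\<^sub>1 A\<^sub>2 = emeasure \<mu> (A\<^sub>1 \<inter> A\<^sub>2) + emeasure \<mu> A\<^sub>1 * emeasure \<mu> A\<^sub>2)"
  show "free_T_point_process \<mu> T P S S' N"
  proof (rule free_if_poisson_second_moment[OF assms])
    fix A B assume "A \<in> pos_finite_sets \<mu>" "B \<in> pos_finite_sets \<mu>" "A \<inter> B = {}"
    then show "second_moment P N A B = emeasure \<mu> A * emeasure \<mu> B" using * by simp
  qed (use * in blast)
next
  fix \<mu>star assume Q: "poisson_law \<mu> \<mu>star"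
  show "free_T_point_process \<mu> T \<mu>star (push_config T) (push_config (inv T)) (\<lambda>\<xi>. \<xi>)"
    by (rule free_if_poisson_second_moment[OF assms poisson_T_point_process[OF assms Q]
          poisson_law_disjoint_moment[OF Q infinite_mp_systemD(1)[OF assms]]])
qed

end
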